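(* For each $N\in\mathbb{N}$ let $W=W^{(N)}$ be a finite index set and let $Y_W=(Y_i)_{i\in W}=(Y_i^{(N)})_{i\in W^{(N)}}$ be a tuple of real random variables of de-Finetti type with respect to some mixing space $(T_N,\mathcal{T}_N,\mu_N,P^{(N)})$. For $K\subseteq W$ let $\mathcal{F}_W(\mathbb{R}^K)$ be the set of tuples $C=(C_i)_{i\in W}$ of measurable functions $C_i:\mathbb{R}^K\to\mathbb{C}$, and let $\mathcal{F}_{W\times W}(\mathbb{R}^K)$ be the set of tuples $C=(C_{i,j})_{i,j\in W}$ of measurable functions $C_{i,j}:\mathbb{R}^K\to\mathbb{C}$. If the first moment condition and the central first moment condition hold, then: (i) $\displaystyle\sum_{i\in I}B_i[Y_K]\,Y_i\prec\sqrt{\sum_{i\in I}|B_i[Y_K]|^2}$, uniformly over all disjoint subsets $I,K\subseteq W$ with $\#I\le N$ and all $B\in\mathcal{F}_W(\mathbb{R}^K)$; (ii) $\displaystyle\sum_{i\in I,\,j\in J}Y_iA_{i,j}[Y_K]Y_j\prec\sqrt{\sum_{i\in I,\,j\in J}|A_{i,j}[Y_K]|^2}$, uniformly over all pairwise disjoint subsets $I,J,K\subseteq W$ with $\#I=\#J\le N$ and all $A\in\mathcal{F}_{W\times W}(\mathbb{R}^K)$; (iii) $\displaystyle\sum_{i,j\in I,\,i\ne j}Y_iA_{i,j}[Y_K]Y_j\prec\sqrt{\sum_{i,j\in I,\,i\ne j}|A_{i,j}[Y_K]|^2}$, uniformly over all disjoint subsets $I,K\subseteq W$ with $\#I\le N$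 and all $A\in\mathcal{F}_{W\times W}(\mathbb{R}^K)$. Further, if the second moment condition and the central second moment condition hold, then the same bounds (i), (ii), (iii) hold after replacing $Y_i$ and $Y_j$ on the left-hand sides by $1-Y_i^2$ and $1-Y_j^2$, respectively (the arguments $Y_K$ remaining unchanged).
   Context: De-Finetti type: for a finite index set $I$, a family $Y_I=(Y_i)_{i\in I}$ of real random variables on a probability space $(\Omega,\mathcal{A},\mathbb{P})$ is of de-Finetti type with respect to the mixing space $(T,\mathcal{T},\mu,P)$ if $(T,\mathcal{T},\mu)$ is a probability space, $P:T\to\mathcal{M}_1(\mathbb{R})$, $t\mapsto P_t$, is measurable ($\mathcal{M}_1(\mathbb{R})$ = Borel probability measures on $\mathbb{R}$ with the Borel $\sigma$-algebra of the weak topology), and $\mathbb{P}(Y_I\in B)=\int_T P_t^{\otimes I}(B)\,d\mu(t)$ for all measurable $B\subseteq\mathbb{R}^I$, where $P_t^{\otimes I}$ is the product measure. Moment conditions: put $m_N^{(\ell)}(t)=\int_{\mathbb{R}}x^\ell\,dP_t^{(N)}(x)$. Each condition is required to hold in the form: for every even $p\in\mathbb{N}$ there is $K_p\ge0$ such that for all $N\in\mathbb{N}$: first moment condition: $\int_{T_N}|m_N^{(1)}(t)|^p\,d\mu_N(t)\le K_pN^{-p/2}$; second moment condition: $\int_{T_N}|1-m_N^{(2)}(t)|^p\,d\mu_N(t)\le K_pN^{-p/2}$; central first moment condition: $\sup_{t\in T_N}\int_{\mathbb{R}}|y-m_N^{(1)}(t)|^p\,dP_t^{(N)}(y)\le K_p$;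 central second moment condition: $\sup_{t\in T_N}\int_{\mathbb{R}}|y^2-m_N^{(2)}(t)|^p\,dP_t^{(N)}(y)\le K_p$. Notation: $Y_K=(Y_i)_{i\in K}$, and $B_i[Y_K]$, $A_{i,j}[Y_K]$ denote the functions $B_i$, $A_{i,j}$ evaluated at $Y_K$. Stochastic domination: for complex random variables $X^{(N)}(u)$ and non-negative random variables $Y^{(N)}(u)$, $u\in U^{(N)}$, we write $X\prec Y$ uniformly in $u\in U^{(N)}$ if for all $\epsilon,D>0$ there is $C_{\epsilon,D}\ge0$ with $\sup_{u\in U^{(N)}}\mathbb{P}(|X^{(N)}(u)|>N^\epsilon Y^{(N)}(u))\le C_{\epsilon,D}N^{-D}$ for all $N\in\mathbb{N}$. *)

theory Defs
  imports "HOL-Probability.Probability"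
begin

definition borel_prob_measures :: "real measure set" where
  "borel_prob_measures = {Q. prob_space Q \<and> sets Q = sets borel}"

text \<open>The coarsest topology on the Borel probability measures for which integration against each
  bounded continuous function is continuous. The choice \<open>V = UNIV\<close> puts the whole set of Borel
  probability measures into the subbase, so it is the carrier of the topology.\<close>

definition weak_topology :: "real measure topology" where
  "weak_topology = topology_generated_by
     {{Q \<in> borel_prob_measures. (\<integral>x. f x \<partial>Q) \<in> V} | (f :: real \<Rightarrow> real) V.
        continuous_on UNIV f \<and> bounded (range f) \<and> open V}"

lemma topspace_weak_topology: "topspace weak_topology = borel_prob_measures"
proof -
  have "borel_prob_measures \<in> {{Q \<in> borel_prob_measures. (\<integral>x. f x \<partial>Q) \<in> V} | (f :: real \<Rightarrow> real) V.
      continuous_on UNIV f \<and> bounded (range f) \<and> open V}"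
    by (rule CollectI, rule exI[of _ "\<lambda>_. 0"], rule exI[of _ UNIV]) auto
  then show ?thesis
    unfolding weak_topology_def topology_generated_by_topspace by blast
qed

definition weak_borel :: "real measure measure" where
  "weak_borel = sigma (topspace weak_topology) {U. openin weak_topology U}"

lemma space_weak_borel: "space weak_borel = borel_prob_measures"
  by (simp add: weak_borel_def topspace_weak_topology space_measure_of_conv)

definition mixing_space :: "'t measure \<Rightarrow> ('t \<Rightarrow> real measure) \<Rightarrow> bool" where
  "mixing_space \<mu> P \<longleftrightarrow> prob_space \<mu> \<and> P \<in> measurable \<mu> weak_borel"

text \<open>\<open>\<real>\<^sup>K\<close> is rendered as the space of the product measure \<open>\<Pi>\<^sub>M i\<in>K. borel\<close>, whose elements are the
  functions that are undefined outside \<open>K\<close>; \<open>subtuple Y K \<omega>\<close> is the point \<open>Y\<^sub>K(\<omega>)\<close> of it.\<close>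

definition subtuple :: "('i \<Rightarrow> 'w \<Rightarrow> real) \<Rightarrow> 'i set \<Rightarrow> 'w \<Rightarrow> 'i \<Rightarrow> real" where
  "subtuple Y K \<omega> = (\<lambda>i\<in>K. Y i \<omega>)"

definition de_Finetti_type ::
    "'w measure \<Rightarrow> 'i set \<Rightarrow> ('i \<Rightarrow> 'w \<Rightarrow> real) \<Rightarrow> 't measure \<Rightarrow> ('t \<Rightarrow> real measure) \<Rightarrow> bool" where
  "de_Finetti_type M I Y \<mu> P \<longleftrightarrow>
     mixing_space \<mu> P \<and>
     (\<forall>B \<in> sets (\<Pi>\<^sub>M i\<in>I. (borel :: real measure)).
        emeasure M {\<omega> \<in> space M. subtuple Y I \<omega> \<in> B} =
          (\<integral>\<^sup>+t. emeasure (\<Pi>\<^sub>M i\<in>I. P t) B \<partial>\<mu>))"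

text \<open>Here and below \<open>N\<close> ranges over \<open>{1, 2, \<dots>}\<close>. The conditions are stated with the
  \<open>[0,\<infinity>]\<close>-valued integral, so each bound includes the finiteness of the integral. In particular, the
  central conditions force \<open>y\<close>, respectively \<open>y\<^sup>2\<close>, to be integrable under every \<open>P\<^sub>t\<close>, so that the
  value \<open>0\<close> that the Bochner integral assigns to a non-integrable function plays no role there.\<close>

definition moment :: "(nat \<Rightarrow> 't \<Rightarrow> real measure) \<Rightarrow> nat \<Rightarrow> nat \<Rightarrow> 't \<Rightarrow> real" where
  "moment P N l t = (\<integral>x. x ^ l \<partial>P N t)"

definition first_moment_condition ::
    "(nat \<Rightarrow> 't measure) \<Rightarrow> (nat \<Rightarrow> 't \<Rightarrow> real measure) \<Rightarrow> bool" where
  "first_moment_condition \<mu> P \<longleftrightarrow>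
     (\<forall>p>0. even p \<longrightarrow> (\<exists>K\<ge>0. \<forall>N\<ge>1.
        (\<integral>\<^sup>+t. ennreal (\<bar>moment P N 1 t\<bar> ^ p) \<partial>\<mu> N) \<le> ennreal (K * real N powr (- real p / 2))))"

definition second_moment_condition ::
    "(nat \<Rightarrow> 't measure) \<Rightarrow> (nat \<Rightarrow> 't \<Rightarrow> real measure) \<Rightarrow> bool" where
  "second_moment_condition \<mu> P \<longleftrightarrow>
     (\<forall>p>0. even p \<longrightarrow> (\<exists>K\<ge>0. \<forall>N\<ge>1.
        (\<integral>\<^sup>+t. ennreal (\<bar>1 - moment P N 2 t\<bar> ^ p) \<partial>\<mu> N) \<le> ennreal (K * real N powr (- real p / 2))))"

definition central_first_moment_condition ::
    "(nat \<Rightarrow> 't measure) \<Rightarrow> (nat \<Rightarrow> 't \<Rightarrow> real measure) \<Rightarrow> bool" where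
  "central_first_moment_condition \<mu> P \<longleftrightarrow>
     (\<forall>p>0. even p \<longrightarrow> (\<exists>K\<ge>0. \<forall>N\<ge>1.
        (SUP t\<in>space (\<mu> N). \<integral>\<^sup>+y. ennreal (\<bar>y - moment P N 1 t\<bar> ^ p) \<partial>P N t) \<le> ennreal K))"

definition central_second_moment_condition ::
    "(nat \<Rightarrow> 't measure) \<Rightarrow> (nat \<Rightarrow> 't \<Rightarrow> real measure) \<Rightarrow> bool" where
  "central_second_moment_condition \<mu> P \<longleftrightarrow>
     (\<forall>p>0. even p \<longrightarrow> (\<exists>K\<ge>0. \<forall>N\<ge>1.
        (SUP t\<in>space (\<mu> N). \<integral>\<^sup>+y. ennreal (\<bar>y\<^sup>2 - moment P N 2 t\<bar> ^ p) \<partial>P N t) \<le> ennreal K))"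

definition fun_tuples :: "'i set \<Rightarrow> 'i set \<Rightarrow> ('i \<Rightarrow> ('i \<Rightarrow> real) \<Rightarrow> complex) set" where
  "fun_tuples W K = {C. \<forall>i\<in>W. C i \<in> borel_measurable (\<Pi>\<^sub>M k\<in>K. (borel :: real measure))}"

definition fun_tuples2 :: "'i set \<Rightarrow> 'i set \<Rightarrow> ('i \<Rightarrow> 'i \<Rightarrow> ('i \<Rightarrow> real) \<Rightarrow> complex) set" where
  "fun_tuples2 W K =
     {C. \<forall>i\<in>W. \<forall>j\<in>W. C i j \<in> borel_measurable (\<Pi>\<^sub>M k\<in>K. (borel :: real measure))}"

text \<open>\<open>X \<prec> Y\<close> uniformly in \<open>u \<in> U N\<close>. The constant \<open>C\<close> depends on \<open>\<epsilon>\<close> and \<open>D\<close> only; the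
  supremum over \<open>u\<close> is written as a bound for every \<open>u\<close>. The notion is meant for random variables
  \<open>X N u\<close>, \<open>Y N u\<close>; for these the event below is measurable.\<close>

definition stoch_dominated ::
    "(nat \<Rightarrow> 'w measure) \<Rightarrow> (nat \<Rightarrow> 'u set) \<Rightarrow>
     (nat \<Rightarrow> 'u \<Rightarrow> 'w \<Rightarrow> complex) \<Rightarrow> (nat \<Rightarrow> 'u \<Rightarrow> 'w \<Rightarrow> real) \<Rightarrow> bool" where
  "stoch_dominated M U X Y \<longleftrightarrow>
     (\<forall>\<epsilon>>0. \<forall>D>0. \<exists>C\<ge>0. \<forall>N\<ge>1. \<forall>u\<in>U N.
        measure (M N) {\<omega> \<in> space (M N). cmod (X N u \<omega>) > real N powr \<epsilon> * Y N u \<omega>}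
          \<le> C * real N powr (- D))"

text \<open>\<open>Y\<close> enters through the argument \<open>Y\<^sub>K\<close> of the coefficient functions, \<open>Z\<close> through the linear and
  bilinear expressions; \<open>Z = Y\<close> and \<open>Z = 1 - Y\<^sup>2\<close> are the cases of interest.\<close>

definition linear_bound ::
    "(nat \<Rightarrow> 'w measure) \<Rightarrow> (nat \<Rightarrow> 'i set) \<Rightarrow>
     (nat \<Rightarrow> 'i \<Rightarrow> 'w \<Rightarrow> real) \<Rightarrow> (nat \<Rightarrow> 'i \<Rightarrow> 'w \<Rightarrow> real) \<Rightarrow> bool" where
  "linear_bound M W Y Z \<longleftrightarrow>
     stoch_dominated M
       (\<lambda>N. {(I, K, B). I \<subseteq> W N \<and> K \<subseteq> W N \<and> I \<inter> K = {} \<and> card I \<le> N \<and> B \<in> fun_tuples (W N) K})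
       (\<lambda>N (I, K, B) \<omega>. \<Sum>i\<in>I. B i (subtuple (Y N) K \<omega>) * complex_of_real (Z N i \<omega>))
       (\<lambda>N (I, K, B) \<omega>. sqrt (\<Sum>i\<in>I. (cmod (B i (subtuple (Y N) K \<omega>)))\<^sup>2))"

definition bilinear_bound ::
    "(nat \<Rightarrow> 'w measure) \<Rightarrow> (nat \<Rightarrow> 'i set) \<Rightarrow>
     (nat \<Rightarrow> 'i \<Rightarrow> 'w \<Rightarrow> real) \<Rightarrow> (nat \<Rightarrow> 'i \<Rightarrow> 'w \<Rightarrow> real) \<Rightarrow> bool" where
  "bilinear_bound M W Y Z \<longleftrightarrow>
     stoch_dominated M
       (\<lambda>N. {(I, J, K, A). I \<subseteq> W N \<and> J \<subseteq> W N \<and> K \<subseteq> W N \<and>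
               I \<inter> J = {} \<and> I \<inter> K = {} \<and> J \<inter> K = {} \<and>
               card I = card J \<and> card J \<le> N \<and> A \<in> fun_tuples2 (W N) K})
       (\<lambda>N (I, J, K, A) \<omega>. \<Sum>(i, j) \<in> I \<times> J.
          complex_of_real (Z N i \<omega>) * A i j (subtuple (Y N) K \<omega>) * complex_of_real (Z N j \<omega>))
       (\<lambda>N (I, J, K, A) \<omega>. sqrt (\<Sum>(i, j) \<in> I \<times> J. (cmod (A i j (subtuple (Y N) K \<omega>)))\<^sup>2))"

definition off_diagonal_bound ::
    "(nat \<Rightarrow> 'w measure) \<Rightarrow> (nat \<Rightarrow> 'i set) \<Rightarrow>
     (nat \<Rightarrow> 'i \<Rightarrow> 'w \<Rightarrow> real) \<Rightarrow> (nat \<Rightarrow> 'i \<Rightarrow> 'w \<Rightarrow> real) \<Rightarrow> bool" where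
  "off_diagonal_bound M W Y Z \<longleftrightarrow>
     stoch_dominated M
       (\<lambda>N. {(I, K, A). I \<subseteq> W N \<and> K \<subseteq> W N \<and> I \<inter> K = {} \<and> card I \<le> N \<and> A \<in> fun_tuples2 (W N) K})
       (\<lambda>N (I, K, A) \<omega>. \<Sum>(i, j) \<in> {(i, j). i \<in> I \<and> j \<in> I \<and> i \<noteq> j}.
          complex_of_real (Z N i \<omega>) * A i j (subtuple (Y N) K \<omega>) * complex_of_real (Z N j \<omega>))
       (\<lambda>N (I, K, A) \<omega>. sqrt (\<Sum>(i, j) \<in> {(i, j). i \<in> I \<and> j \<in> I \<and> i \<noteq> j}.
          (cmod (A i j (subtuple (Y N) K \<omega>)))\<^sup>2))"

end

theory Submission
  imports Defs
begin

text \<open>Conditionally on the mixing parameter \<open>t\<close> the variables \<open>Y\<^sub>i\<close> are independent with common law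
  \<open>P\<^sub>t\<close>, and since \<open>K\<close> is disjoint from the other index sets, conditionally on \<open>Y\<^sub>K\<close> too the
  coefficients become constants while the remaining variables keep this law. So the theorem reduces
  to a moment bound for linear and bilinear forms with deterministic coefficients in independent
  variables \<open>Z\<^sub>i\<close> with mean \<open>m\<close> and bounded central moments, with constants that do not depend on
  \<open>t\<close>, on the coefficients or on the index sets.

  For \<open>m = 0\<close> the forms are built up one variable at a time. Adding the index \<open>i\<close> changes the form by
  \<open>X\<^sub>i L\<close>, where \<open>X\<^sub>i\<close> is centred and independent of both \<open>L\<close> and the form so far; \<open>L\<close> is a constant
  for a linear form and a linear form for an off-diagonal quadratic form. The lemma
  \<open>moment_add_independent_increment\<close> propagates the bound \<open>E Q\<^sup>p \<le> D F\<^sup>p\<^sup>/\<^sup>2\<close> through one such step,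
  with the \<^emph>\<open>same\<close> \<open>D\<close>, so that induction over the index set gives an estimate independent of its
  size (a Burkholder-type inequality). It is used twice: for linear forms, and then, with the result
  for \<open>L\<close>, for quadratic forms.

  For \<open>m \<noteq> 0\<close> the forms are expanded around \<open>m\<close>. By the Cauchy-Schwarz inequality each factor \<open>m\<close>
  costs a factor \<open>sqrt n\<close>, \<open>n\<close> being the number of variables, so the bound for the \<open>p\<close>-th moments grows by a
  constant multiple of \<open>1 + (n m\<^sup>2)\<^sup>p\<close>. The moment condition on the mean says that \<open>m\<close> is of order \<open>N\<^sup>-\<^sup>1\<^sup>/\<^sup>2\<close> as a
  function of \<open>t\<close>, and \<open>n \<le> 2 N\<close>, so this factor has a bounded integral with respect to \<open>t\<close>. Markov's
  inequality with a moment of order \<open>p \<ge> D / \<epsilon>\<close> concludes (\<open>stoch_dominated_if_conditional_tail\<close>).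

  A bilinear form over disjoint \<open>I\<close> and \<open>J\<close> is the off-diagonal form over \<open>I \<union> J\<close> with coefficients
  extended by zero. The two halves of the theorem are the cases \<open>z y = y\<close> and \<open>z y = 1 - y\<^sup>2\<close> of
  \<open>Z\<^sub>i = z (Y\<^sub>i)\<close> for a continuous function \<open>z\<close>.\<close>

section \<open>Elementary inequalities for even powers\<close>

text \<open>Only the term linear in \<open>u\<close> is kept exactly: it has mean zero when \<open>u\<close> carries a centred
  factor independent of \<open>s\<close>. In each further binomial term two factors \<open>u\<close> are split off and the
  rest is estimated by the larger one of \<open>\<bar>s\<bar>\<close> and \<open>\<bar>u\<bar>\<close>.\<close>
lemma power_add_taylor_bound:
  fixes s u :: real
  assumes "even n"
  shows "(s + u) ^ (n + 2) \<le> s ^ (n + 2) + real (n + 2) * (s ^ (n + 1) * u)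
           + 2 ^ (n + 2) * (u\<^sup>2 * s ^ n + u ^ (n + 2))"
proof -
  have summand: "real (n + 2 choose (j + 2)) * u ^ (j + 2) * s ^ (n - j)
      \<le> real (n + 2 choose (j + 2)) * (u\<^sup>2 * s ^ n + u ^ (n + 2))" if "j \<le> n" for j
  proof -
    define m where "m = max \<bar>u\<bar> \<bar>s\<bar>"
    have "u ^ j * s ^ (n - j) \<le> \<bar>u\<bar> ^ j * \<bar>s\<bar> ^ (n - j)"
      using abs_ge_self[of "u ^ j * s ^ (n - j)"] by (simp add: abs_mult power_abs)
    also have "\<dots> \<le> m ^ j * m ^ (n - j)"
      by (intro mult_mono power_mono) (auto simp: m_def)
    also have "\<dots> = m ^ n" using that by (simp flip: power_add)
    also have "\<dots> \<le> s ^ n + u ^ n"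
      using assms by (auto simp: m_def max_def power_even_abs zero_le_even_power)
    finally have "u\<^sup>2 * (u ^ j * s ^ (n - j)) \<le> u\<^sup>2 * (s ^ n + u ^ n)"
      by (intro mult_left_mono) auto
    then have "u ^ (j + 2) * s ^ (n - j) \<le> u\<^sup>2 * s ^ n + u ^ (n + 2)"
      by (simp add: power_add power2_eq_square algebra_simps)
    from mult_left_mono[OF this, of "real (n + 2 choose (j + 2))"] show ?thesis
      by (simp add: algebra_simps)
  qed
  have nonneg: "0 \<le> u\<^sup>2 * s ^ n + u ^ (n + 2)"
    using assms by (intro add_nonneg_nonneg mult_nonneg_nonneg zero_le_even_power) auto
  have "(s + u) ^ (n + 2) = (\<Sum>j\<le>Suc (Suc n). real (n + 2 choose j) * u ^ j * s ^ (n + 2 - j))"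
    by (subst add.commute, subst binomial_ring) simp
  also have "\<dots> = s ^ (n + 2) + real (n + 2) * (s ^ (n + 1) * u)
      + (\<Sum>j\<le>n. real (n + 2 choose (j + 2)) * u ^ (j + 2) * s ^ (n - j))"
    by (subst sum.atMost_Suc_shift, subst sum.atMost_Suc_shift) (simp add: algebra_simps)
  also have "(\<Sum>j\<le>n. real (n + 2 choose (j + 2)) * u ^ (j + 2) * s ^ (n - j))
      \<le> (\<Sum>j\<le>n. real (n + 2 choose (j + 2))) * (u\<^sup>2 * s ^ n + u ^ (n + 2))"
    unfolding sum_distrib_right by (intro sum_mono summand) auto
  also have "\<dots> \<le> 2 ^ (n + 2) * (u\<^sup>2 * s ^ n + u ^ (n + 2))"
  proof (rule mult_right_mono[OF _ nonneg])
    have "(\<Sum>j\<le>Suc (Suc n). real (n + 2 choose j)) = 2 ^ (n + 2)"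
      using choose_row_sum[of "n + 2"] by (simp flip: of_nat_sum) 
    moreover have "(\<Sum>j\<le>Suc (Suc n). real (n + 2 choose j))
       = 1 + real (n + 2) + (\<Sum>j\<le>n. real (n + 2 choose (j + 2)))"
      by (subst sum.atMost_Suc_shift, subst sum.atMost_Suc_shift) simp
    ultimately show "(\<Sum>j\<le>n. real (n + 2 choose (j + 2))) \<le> 2 ^ (n + 2)"
      by linarith
  qed
  finally show ?thesis by simp
qed

text \<open>A form of Young's inequality that needs no fractional exponents: either \<open>x\<^sup>2 \<le> \<theta> y\<^sup>2\<close>, and
  the first term suffices, or \<open>y\<^sup>2\<close> is less than \<open>x\<^sup>2 / \<theta>\<close>, and the second does. It stands in for
  Hoelder's inequality; the weight \<open>\<theta>\<close> will be proportional to the ratio of the sizes of \<open>x\<^sup>2\<close> and \<open>y\<^sup>2\<close>.\<close>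
lemma power_mult_le_weighted:
  fixes x y \<theta> :: real
  assumes "0 < \<theta>"
  shows "x\<^sup>2 * y ^ (2 * r) \<le> \<theta> * y ^ (2 * r + 2) + x ^ (2 * r + 2) / \<theta> ^ r"
proof (cases "x\<^sup>2 \<le> \<theta> * y\<^sup>2")
  case True
  have "x\<^sup>2 * y ^ (2 * r) \<le> (\<theta> * y\<^sup>2) * y ^ (2 * r)"
    by (rule mult_right_mono[OF True zero_le_even_power'])
  moreover have "0 \<le> x ^ (2 * r + 2) / \<theta> ^ r"
    using zero_le_even_power'[of x "r + 1"] assms by simp
  ultimately show ?thesis by (simp add: power_add power2_eq_square algebra_simps)
next
  case False
  then have "y\<^sup>2 \<le> x\<^sup>2 / \<theta>" using assms by (simp add: field_simps)
  then have "(y\<^sup>2) ^ r \<le> (x\<^sup>2 / \<theta>) ^ r" by (intro power_mono) auto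
  then have "x\<^sup>2 * (y\<^sup>2) ^ r \<le> x\<^sup>2 * (x\<^sup>2 / \<theta>) ^ r" by (intro mult_left_mono) auto
  moreover have "0 \<le> \<theta> * y ^ (2 * r + 2)"
    using assms by (intro mult_nonneg_nonneg zero_le_even_power) auto
  moreover have "z ^ (2 * r) = (z\<^sup>2) ^ r" "z ^ (2 * r + 2) = z\<^sup>2 * (z\<^sup>2) ^ r" for z :: real
    by (rule power_mult, metis power_add power_mult mult.commute)
  ultimately show ?thesis by (simp only: power_divide times_divide_eq_right)
qed

lemma abs_power_mult_le_powers:
  fixes x y :: real
  assumes "even (i + j)"
  shows "\<bar>x ^ i * y ^ j\<bar> \<le> x ^ (i + j) + y ^ (i + j)"
proof -
  define m where "m = max \<bar>x\<bar> \<bar>y\<bar>"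
  have "\<bar>x ^ i * y ^ j\<bar> \<le> m ^ i * m ^ j"
    unfolding abs_mult power_abs by (intro mult_mono power_mono) (auto simp: m_def)
  also have "\<dots> = m ^ (i + j)" by (simp add: power_add)
  also have "\<dots> \<le> x ^ (i + j) + y ^ (i + j)"
    using assms by (auto simp: m_def max_def power_even_abs zero_le_even_power)
  finally show ?thesis .
qed

lemma integrable_power_mult:
  fixes f g :: "'a \<Rightarrow> real"
  assumes "integrable M (\<lambda>x. f x ^ (i + j))" "integrable M (\<lambda>x. g x ^ (i + j))"
    and [measurable]: "f \<in> borel_measurable M" "g \<in> borel_measurable M" and "even (i + j)"
  shows "integrable M (\<lambda>x. f x ^ i * g x ^ j)"
  by (rule Bochner_Integration.integrable_bound[OF Bochner_Integration.integrable_add[OF assms(1,2)]])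
     (auto intro!: AE_I2 order_trans[OF abs_power_mult_le_powers[OF assms(5)] abs_ge_self])

section \<open>Adding an independent centred increment\<close>

text \<open>The value is dictated by \<open>increment_const_absorbs\<close>: the constant \<open>D\<close> for the moments of a
  form must solve the linear equation stated there. With the Young parameter \<open>\<delta>\<close> the coefficient of
  \<open>D\<close> on the left-hand side is \<open>1/2\<close>, so a solution exists. Here \<open>K\<close> bounds the moments of the
  variables and \<open>C\<close> is the constant for the factor \<open>L\<close> of the increment.\<close>
definition increment_const :: "nat \<Rightarrow> real \<Rightarrow> real \<Rightarrow> real" where
  "increment_const r K C =
     (let c = 2 ^ (2 * r + 2); \<delta> = 1 / (2 * c * (1 + K)) in 2 * c * ((1 + K) * C / \<delta> ^ r + K * C))"

lemma increment_const_absorbs: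
  fixes c K C \<delta> D :: real and r :: nat
  assumes "0 \<le> K" "0 \<le> C" 
  defines "c \<equiv> 2 ^ (2 * r + 2)" and "\<delta> \<equiv> 1 / (2 * c * (1 + K))" and "D \<equiv> increment_const r K C"
  shows "0 \<le> D" "0 < \<delta>" "c * ((1 + K) * (\<delta> * D + C / \<delta> ^ r) + K * C) = D"
proof -
  have c: "c > 0" by (simp add: c_def)
  show d: "0 < \<delta>" using c assms(1) by (simp add: \<delta>_def)
  have D: "D = 2 * c * ((1 + K) * C / \<delta> ^ r + K * C)"
    by (simp add: D_def increment_const_def c_def \<delta>_def Let_def)
  show "0 \<le> D" unfolding D using c d assms(1,2) by (intro mult_nonneg_nonneg add_nonneg_nonneg divide_nonneg_nonneg) auto
  have "c * (1 + K) * \<delta> = 1/2" using c assms(1) by (simp add: \<delta>_def)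
  then have "c * (1 + K) * \<delta> * D = D / 2" by simp
  moreover have "c * ((1 + K) * (\<delta> * D + C / \<delta> ^ r) + K * C) = c * (1 + K) * \<delta> * D + D / 2"
    unfolding D by (simp add: algebra_simps)
  ultimately show "c * ((1 + K) * (\<delta> * D + C / \<delta> ^ r) + K * C) = D" by linarith
qed

context prob_space
begin

lemma expectation_indep_powers:
  fixes X Q L :: "'a \<Rightarrow> real"
  assumes ind: "\<And>h. h \<in> borel_measurable (borel \<Otimes>\<^sub>M borel) \<Longrightarrow> indep_var borel X borel (\<lambda>\<omega>. h (Q \<omega>, L \<omega>))"
    and "integrable M (\<lambda>\<omega>. X \<omega> ^ i)" "integrable M (\<lambda>\<omega>. L \<omega> ^ j * Q \<omega> ^ k)"
  shows "integrable M (\<lambda>\<omega>. X \<omega> ^ i * (L \<omega> ^ j * Q \<omega> ^ k))"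
    and "expectation (\<lambda>\<omega>. X \<omega> ^ i * (L \<omega> ^ j * Q \<omega> ^ k))
         = expectation (\<lambda>\<omega>. X \<omega> ^ i) * expectation (\<lambda>\<omega>. L \<omega> ^ j * Q \<omega> ^ k)"
proof -
  have "indep_var borel ((\<lambda>x. x ^ i) \<circ> X) borel (id \<circ> (\<lambda>\<omega>. (\<lambda>(q, l). l ^ j * q ^ k) (Q \<omega>, L \<omega>)))"
    by (rule indep_var_compose[OF ind]) measurable
  then have *: "indep_var borel (\<lambda>\<omega>. X \<omega> ^ i) borel (\<lambda>\<omega>. L \<omega> ^ j * Q \<omega> ^ k)"
    by (simp add: comp_def)
  show "integrable M (\<lambda>\<omega>. X \<omega> ^ i * (L \<omega> ^ j * Q \<omega> ^ k))"
    "expectation (\<lambda>\<omega>. X \<omega> ^ i * (L \<omega> ^ j * Q \<omega> ^ k))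
         = expectation (\<lambda>\<omega>. X \<omega> ^ i) * expectation (\<lambda>\<omega>. L \<omega> ^ j * Q \<omega> ^ k)"
    using indep_var_integrable[OF * assms(2,3)] indep_var_lebesgue_integral[OF * assms(2,3)] by auto
qed

lemma integrable_power_le:
  fixes X :: "'a \<Rightarrow> real"
  assumes [measurable]: "X \<in> borel_measurable M" and X: "integrable M (\<lambda>\<omega>. X \<omega> ^ p)" and "even p" "i \<le> p"
  shows "integrable M (\<lambda>\<omega>. X \<omega> ^ i)" "expectation (\<lambda>\<omega>. X \<omega> ^ i) \<le> 1 + expectation (\<lambda>\<omega>. X \<omega> ^ p)"
proof -
  have b: "\<bar>X \<omega> ^ i\<bar> \<le> 1 + X \<omega> ^ p" for \<omega>
    using abs_power_mult_le_powers[of i "p - i" "X \<omega>" 1] \<open>even p\<close> \<open>i \<le> p\<close> by simp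
  show i: "integrable M (\<lambda>\<omega>. X \<omega> ^ i)"
    by (rule Bochner_Integration.integrable_bound[of _ "\<lambda>\<omega>. 1 + X \<omega> ^ p"])
       (use X in \<open>auto intro!: AE_I2 order_trans[OF b abs_ge_self]\<close>)
  have "expectation (\<lambda>\<omega>. X \<omega> ^ i) \<le> expectation (\<lambda>\<omega>. 1 + X \<omega> ^ p)"
    using b by (intro integral_mono i) (auto simp: X abs_le_iff)
  then show "expectation (\<lambda>\<omega>. X \<omega> ^ i) \<le> 1 + expectation (\<lambda>\<omega>. X \<omega> ^ p)"
    using X by (simp add: prob_space)
qed

text \<open>The quantities \<open>F\<close> and \<open>f\<close> measure the squared sizes of \<open>Q\<close> and \<open>L\<close>. In the Taylor bound for
  \<open>(Q + X L)\<^sup>p\<close> the linear term vanishes in expectation, and the remainder is at most a constant times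
  \<open>f (F + f)\<^sup>r\<close>, where \<open>D f (F + f)\<^sup>r \<le> D (F + f)\<^sup>r\<^sup>+\<^sup>1 - D F\<^sup>r\<^sup>+\<^sup>1\<close>. Therefore the constant in front does not
  deteriorate, provided that it is large enough to absorb the one in the remainder, which contains
  only a small multiple of it.

  Independence of \<open>X\<close> from the pair \<open>(Q, L)\<close> is expressed through real functions \<open>h\<close> of the pair,
  because \<^const>\<open>prob_space.indep_var\<close> relates variables with values in one common type.\<close>
lemma moment_add_independent_increment:
  fixes X Q L :: "'a \<Rightarrow> real" and r :: nat
  defines "p \<equiv> 2 * r + 2"
  assumes ind: "\<And>h. h \<in> borel_measurable (borel \<Otimes>\<^sub>M borel) \<Longrightarrow> indep_var borel X borel (\<lambda>\<omega>. h (Q \<omega>, L \<omega>))"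
    and [measurable]: "X \<in> borel_measurable M" "Q \<in> borel_measurable M" "L \<in> borel_measurable M"
    and X: "integrable M (\<lambda>\<omega>. X \<omega> ^ p)" "expectation X = 0" "expectation (\<lambda>\<omega>. X \<omega> ^ p) \<le> K"
    and L: "integrable M (\<lambda>\<omega>. L \<omega> ^ p)" "expectation (\<lambda>\<omega>. L \<omega> ^ p) \<le> C * f ^ (r + 1)"
    and Q: "integrable M (\<lambda>\<omega>. Q \<omega> ^ p)"
      "expectation (\<lambda>\<omega>. Q \<omega> ^ p) \<le> increment_const r K C * F ^ (r + 1)"
    and nonneg: "0 \<le> C" "0 \<le> f" "0 \<le> F"
  shows "integrable M (\<lambda>\<omega>. (Q \<omega> + X \<omega> * L \<omega>) ^ p)"
    and "expectation (\<lambda>\<omega>. (Q \<omega> + X \<omega> * L \<omega>) ^ p) \<le> increment_const r K C * (F + f) ^ (r + 1)"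
proof -
  define c \<delta> D :: real where "c = 2 ^ (2 * r + 2)" and "\<delta> = 1 / (2 * c * (1 + K))"
    and "D = increment_const r K C"
  have evp: "even p" by (simp add: p_def)
  have "0 \<le> expectation (\<lambda>\<omega>. X \<omega> ^ p)"
    by (intro integral_nonneg_AE AE_I2 zero_le_even_power evp)
  with X have K: "0 \<le> K" by simp
  note D = increment_const_absorbs[OF K nonneg(1), of r, folded c_def, folded \<delta>_def D_def]
  have X1: "integrable M (\<lambda>\<omega>. X \<omega> ^ i)" if "i \<le> p" for i
    by (rule integrable_power_le[OF _ X(1) evp that]) auto
  have X2: "expectation (\<lambda>\<omega>. (X \<omega>)\<^sup>2) \<le> 1 + K"
    using integrable_power_le(2)[OF _ X(1) evp, of 2] X(3) by (simp add: p_def)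
  have LQ: "integrable M (\<lambda>\<omega>. L \<omega> ^ i * Q \<omega> ^ j)" if "i + j = p" for i j
    using L(1) Q(1) evp that by (intro integrable_power_mult) auto
  have exponents: "1 \<le> p" "1 + (2 * r + 1) = p" "2 \<le> p" "2 + 2 * r = p" "p \<le> p" "p + 0 = p"
    by (simp_all add: p_def)
  note XLQ = expectation_indep_powers[OF ind X1[OF exponents(1)] LQ[OF exponents(2)]]
    expectation_indep_powers[OF ind X1[OF exponents(3)] LQ[OF exponents(4)]]
    expectation_indep_powers[OF ind X1[OF exponents(5)] LQ[OF exponents(6)]]
  have xl: "Q \<omega> ^ (2 * r + 1) * (X \<omega> * L \<omega>) = X \<omega> ^ 1 * (L \<omega> ^ 1 * Q \<omega> ^ (2 * r + 1))"
    "(X \<omega> * L \<omega>)\<^sup>2 * Q \<omega> ^ (2 * r) = (X \<omega>)\<^sup>2 * ((L \<omega>)\<^sup>2 * Q \<omega> ^ (2 * r))"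
    "(X \<omega> * L \<omega>) ^ p = X \<omega> ^ p * (L \<omega> ^ p * Q \<omega> ^ 0)" for \<omega>
    by (simp_all add: power_mult_distrib)
  let ?rhs = "\<lambda>\<omega>. Q \<omega> ^ p + real p * (X \<omega> ^ 1 * (L \<omega> ^ 1 * Q \<omega> ^ (2 * r + 1)))
     + c * ((X \<omega>)\<^sup>2 * ((L \<omega>)\<^sup>2 * Q \<omega> ^ (2 * r)) + X \<omega> ^ p * (L \<omega> ^ p * Q \<omega> ^ 0))"
  have taylor: "(Q \<omega> + X \<omega> * L \<omega>) ^ p \<le> ?rhs \<omega>" for \<omega>
    using power_add_taylor_bound[of "2 * r" "Q \<omega>" "X \<omega> * L \<omega>"]
    unfolding p_def c_def xl[unfolded p_def, symmetric] by simp
  have int_rhs: "integrable M ?rhs"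
    by (intro Bochner_Integration.integrable_add Bochner_Integration.integrable_mult_right Q(1) XLQ)
  show int: "integrable M (\<lambda>\<omega>. (Q \<omega> + X \<omega> * L \<omega>) ^ p)"
    by (rule Bochner_Integration.integrable_bound[OF int_rhs])
       (use taylor evp in \<open>auto intro!: AE_I2 simp: zero_le_even_power intro: order_trans[OF _ abs_ge_self]\<close>)
  have "expectation (\<lambda>\<omega>. (Q \<omega> + X \<omega> * L \<omega>) ^ p) \<le> expectation ?rhs"
    by (intro integral_mono int int_rhs taylor)
  also have "\<dots> = expectation (\<lambda>\<omega>. Q \<omega> ^ p)
      + real p * (expectation (\<lambda>\<omega>. X \<omega> ^ 1) * expectation (\<lambda>\<omega>. L \<omega> ^ 1 * Q \<omega> ^ (2 * r + 1)))
      + c * (expectation (\<lambda>\<omega>. (X \<omega>)\<^sup>2) * expectation (\<lambda>\<omega>. (L \<omega>)\<^sup>2 * Q \<omega> ^ (2 * r))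
        + expectation (\<lambda>\<omega>. X \<omega> ^ p) * expectation (\<lambda>\<omega>. L \<omega> ^ p * Q \<omega> ^ 0))"
    using XLQ Q(1) by (simp del: power_one_right power_0 mult_1_right)
  also have "\<dots> \<le> D * F ^ (r + 1)
      + c * ((1 + K) * expectation (\<lambda>\<omega>. (L \<omega>)\<^sup>2 * Q \<omega> ^ (2 * r)) + K * (C * f ^ (r + 1)))"
  proof -
    have "0 \<le> expectation (\<lambda>\<omega>. (L \<omega>)\<^sup>2 * Q \<omega> ^ (2 * r))" "0 \<le> expectation (\<lambda>\<omega>. L \<omega> ^ p)"
      by (intro integral_nonneg_AE AE_I2 mult_nonneg_nonneg zero_le_even_power evp; simp)+
    then have "expectation (\<lambda>\<omega>. (X \<omega>)\<^sup>2) * expectation (\<lambda>\<omega>. (L \<omega>)\<^sup>2 * Q \<omega> ^ (2 * r))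
          \<le> (1 + K) * expectation (\<lambda>\<omega>. (L \<omega>)\<^sup>2 * Q \<omega> ^ (2 * r))"
        "expectation (\<lambda>\<omega>. X \<omega> ^ p) * expectation (\<lambda>\<omega>. L \<omega> ^ p) \<le> K * (C * f ^ (r + 1))"
      using X2 X(3) L(2) K by (auto intro!: mult_right_mono mult_mono)
    then have "c * (expectation (\<lambda>\<omega>. (X \<omega>)\<^sup>2) * expectation (\<lambda>\<omega>. (L \<omega>)\<^sup>2 * Q \<omega> ^ (2 * r))
        + expectation (\<lambda>\<omega>. X \<omega> ^ p) * expectation (\<lambda>\<omega>. L \<omega> ^ p))
       \<le> c * ((1 + K) * expectation (\<lambda>\<omega>. (L \<omega>)\<^sup>2 * Q \<omega> ^ (2 * r)) + K * (C * f ^ (r + 1)))"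
      by (intro mult_left_mono add_mono) (auto simp: c_def)
    then show ?thesis using Q(2) X(2) by (simp add: D_def)
  qed
  also have "\<dots> \<le> D * F ^ (r + 1) + c * ((1 + K) * (F ^ r * f * (\<delta> * D + C / \<delta> ^ r)) + K * (C * f ^ (r + 1)))"
  proof -
    have "expectation (\<lambda>\<omega>. (L \<omega>)\<^sup>2 * Q \<omega> ^ (2 * r)) \<le> F ^ r * f * (\<delta> * D + C / \<delta> ^ r)"
    proof (rule tendsto_lowerbound)
      \<comment> \<open>The sizes are enlarged by \<open>\<eta> > 0\<close> to make their ratio, the Young weight, well defined.\<close>
      show "((\<lambda>\<eta>. (F + \<eta>) ^ r * (f + \<eta>) * (\<delta> * D + C / \<delta> ^ r))
          \<longlongrightarrow> F ^ r * f * (\<delta> * D + C / \<delta> ^ r)) (at_right 0)"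
        by (rule tendsto_eq_intros refl | simp)+
      show "\<forall>\<^sub>F \<eta> in at_right 0. expectation (\<lambda>\<omega>. (L \<omega>)\<^sup>2 * Q \<omega> ^ (2 * r))
          \<le> (F + \<eta>) ^ r * (f + \<eta>) * (\<delta> * D + C / \<delta> ^ r)"
        using eventually_at_right_less
      proof eventually_elim
        case (elim \<eta>)
        define F' f' \<theta> where "F' = F + \<eta>" and "f' = f + \<eta>" and "\<theta> = \<delta> * f' / F'"
        have pos: "0 < F'" "0 < f'" "0 < \<theta>"
          using elim nonneg D(2) by (auto simp: F'_def f'_def \<theta>_def)
        have "expectation (\<lambda>\<omega>. (L \<omega>)\<^sup>2 * Q \<omega> ^ (2 * r))
            \<le> expectation (\<lambda>\<omega>. \<theta> * Q \<omega> ^ p + L \<omega> ^ p / \<theta> ^ r)"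
          using power_mult_le_weighted[OF pos(3)] LQ[of 2 "2 * r"] Q(1) L(1)
          by (intro integral_mono) (auto simp: p_def)
        also have "\<dots> = \<theta> * expectation (\<lambda>\<omega>. Q \<omega> ^ p) + expectation (\<lambda>\<omega>. L \<omega> ^ p) / \<theta> ^ r"
          using Q(1) L(1) by simp
        also have "\<dots> \<le> \<theta> * (D * F' ^ (r + 1)) + C * f' ^ (r + 1) / \<theta> ^ r"
        proof (intro add_mono mult_left_mono divide_right_mono)
          show "expectation (\<lambda>\<omega>. Q \<omega> ^ p) \<le> D * F' ^ (r + 1)"
            using Q(2) D(1) nonneg elim unfolding D_def[symmetric] F'_def
            by (elim order_trans) (intro mult_left_mono power_mono, auto)
          show "expectation (\<lambda>\<omega>. L \<omega> ^ p) \<le> C * f' ^ (r + 1)"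
            using L(2) nonneg elim unfolding f'_def
            by (elim order_trans) (intro mult_left_mono power_mono, auto)
        qed (use pos in auto)
        also have "\<dots> = F' ^ r * f' * (\<delta> * D + C / \<delta> ^ r)"
          using pos D(2) by (simp add: \<theta>_def power_divide power_mult_distrib field_simps)
        finally show ?case unfolding F'_def f'_def .
      qed
    qed simp
    then show ?thesis using K by (intro add_left_mono mult_left_mono add_right_mono) (auto simp: c_def)
  qed
  also have "\<dots> \<le> D * F * (F + f) ^ r + c * ((1 + K) * (\<delta> * D + C / \<delta> ^ r) + K * C) * (f * (F + f) ^ r)"
  proof -
    have "F ^ r \<le> (F + f) ^ r" "f ^ r \<le> (F + f) ^ r"
      using nonneg by (auto intro: power_mono)
    then have "D * F * F ^ r \<le> D * F * (F + f) ^ r"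
      "c * (1 + K) * (\<delta> * D + C / \<delta> ^ r) * f * F ^ r \<le> c * (1 + K) * (\<delta> * D + C / \<delta> ^ r) * f * (F + f) ^ r"
      "c * K * C * f * f ^ r \<le> c * K * C * f * (F + f) ^ r"
      using nonneg K D(1,2) by (auto intro!: mult_left_mono mult_nonneg_nonneg simp: c_def)
    then show ?thesis by (simp add: algebra_simps)
  qed
  also have "\<dots> = D * (F + f) ^ (r + 1)" unfolding D(3) by (simp add: algebra_simps)
  finally show "expectation (\<lambda>\<omega>. (Q \<omega> + X \<omega> * L \<omega>) ^ p) \<le> increment_const r K C * (F + f) ^ (r + 1)"
    unfolding D_def .
qed

end

section \<open>Sums over pairs of distinct indices\<close>

definition off_diag :: "'i set \<Rightarrow> ('i \<times> 'i) set" where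
  "off_diag I = {(i, j). i \<in> I \<and> j \<in> I \<and> i \<noteq> j}"

lemma off_diag_Sigma: "off_diag I = (SIGMA i:I. I - {i})"
  by (auto simp: off_diag_def)

lemma finite_off_diag: "finite I \<Longrightarrow> finite (off_diag I)"
  by (auto simp: off_diag_Sigma)

lemma card_off_diag_le: "finite I \<Longrightarrow> card (off_diag I) \<le> card I * card I"
  unfolding card_cartesian_product[symmetric] by (intro card_mono) (auto simp: off_diag_def)

lemma sum_off_diag: "finite I \<Longrightarrow> (\<Sum>x\<in>off_diag I. g x) = (\<Sum>i\<in>I. \<Sum>j\<in>I - {i}. g (i, j))"
  by (simp add: off_diag_Sigma sum.Sigma)

lemma sum_off_diag_swap: "(\<Sum>(i, j)\<in>off_diag I. g j i) = (\<Sum>(i, j)\<in>off_diag I. g i j)"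
  by (rule sum.reindex_bij_witness[of _ prod.swap prod.swap]) (auto simp: off_diag_def)

text \<open>The new pairs are those with exactly one entry \<open>i\<close>; for a quadratic form they make up the
  increment when the variable with index \<open>i\<close> is added.\<close>
lemma sum_off_diag_insert:
  fixes g :: "'i \<times> 'i \<Rightarrow> 'b :: comm_monoid_add"
  assumes "finite I" "i \<notin> I"
  shows "(\<Sum>x\<in>off_diag (insert i I). g x) = (\<Sum>x\<in>off_diag I. g x) + (\<Sum>j\<in>I. g (i, j) + g (j, i))"
proof -
  have "off_diag (insert i I) = off_diag I \<union> (Pair i ` I \<union> (\<lambda>j. (j, i)) ` I)"
    using assms by (auto simp: off_diag_def)
  also have "sum g \<dots> = sum g (off_diag I) + (sum g (Pair i ` I) + sum g ((\<lambda>j. (j, i)) ` I))"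
    using assms by (subst sum.union_disjoint; (subst sum.union_disjoint)?)
      (auto simp: finite_off_diag, auto simp: off_diag_def)
  finally show ?thesis
    by (simp add: sum.reindex inj_on_def sum.distrib comp_def)
qed

text \<open>This reduces bilinear forms over disjoint index sets to off-diagonal forms.\<close>
lemma sum_Times_eq_off_diag:
  assumes "finite I" "finite J" "I \<inter> J = {}" and "\<And>i j. g i j 0 = 0"
  shows "(\<Sum>(i, j)\<in>I \<times> J. g i j (a i j))
       = (\<Sum>(i, j)\<in>off_diag (I \<union> J). g i j (if i \<in> I \<and> j \<in> J then a i j else (0 :: 'c :: zero)) :: 'd :: comm_monoid_add)"
  using assms
  by (intro sum.mono_neutral_cong_left finite_off_diag) (auto simp: off_diag_def split: if_splits)

lemma power2_sum_le: "(x + y)\<^sup>2 \<le> 2 * (x\<^sup>2 + y\<^sup>2)" for x y :: real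
  using sum_squares_bound[of x y] by (simp add: power2_sum)

text \<open>Controls the linear form that arises when one of the two variables in an off-diagonal form is
  replaced by its mean: the Cauchy-Schwarz inequality costs a factor \<open>n\<close>.\<close>
lemma sum_squares_of_sums_off_diag_le:
  fixes a :: "'i \<Rightarrow> 'i \<Rightarrow> real"
  assumes "finite I" "card I \<le> n"
  shows "(\<Sum>i\<in>I. (\<Sum>j\<in>I - {i}. a i j + a j i)\<^sup>2) \<le> 4 * real n * (\<Sum>(i, j)\<in>off_diag I. (a i j)\<^sup>2)"
proof -
  have "(\<Sum>j\<in>I - {i}. a i j + a j i)\<^sup>2 \<le> real n * (\<Sum>j\<in>I - {i}. 2 * ((a i j)\<^sup>2 + (a j i)\<^sup>2))" for i
  proof -
    have "(\<Sum>j\<in>I - {i}. a i j + a j i)\<^sup>2 \<le> (\<Sum>j\<in>I - {i}. (a i j + a j i)\<^sup>2) * card (I - {i})"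
      by (rule sum_squared_le_sum_of_squares)
    also have "\<dots> \<le> (\<Sum>j\<in>I - {i}. 2 * ((a i j)\<^sup>2 + (a j i)\<^sup>2)) * n"
    proof (intro mult_mono sum_mono)
      have "card (I - {i}) \<le> card I" using assms by (intro card_mono) auto
      then show "real (card (I - {i})) \<le> real n" using assms by linarith
    qed (use power2_sum_le in \<open>auto intro!: sum_nonneg\<close>)
    finally show ?thesis by (simp add: mult.commute)
  qed
  then have "(\<Sum>i\<in>I. (\<Sum>j\<in>I - {i}. a i j + a j i)\<^sup>2)
      \<le> (\<Sum>i\<in>I. n * (\<Sum>j\<in>I - {i}. 2 * ((a i j)\<^sup>2 + (a j i)\<^sup>2)))"
    by (rule sum_mono)
  also have "\<dots> = 2 * real n * ((\<Sum>(i, j)\<in>off_diag I. (a i j)\<^sup>2) + (\<Sum>(i, j)\<in>off_diag I. (a j i)\<^sup>2))"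
    using assms by (simp add: sum_off_diag sum.distrib sum_distrib_left algebra_simps)
  also have "(\<Sum>(i, j)\<in>off_diag I. (a j i)\<^sup>2) = (\<Sum>(i, j)\<in>off_diag I. (a i j)\<^sup>2)"
    by (rule sum_off_diag_swap)
  finally show ?thesis by simp
qed

lemma off_diag_form_shift:
  fixes a :: "'i \<Rightarrow> 'i \<Rightarrow> real"
  assumes "finite I"
  shows "(\<Sum>(i, j)\<in>off_diag I. (x i + m) * a i j * (x j + m))
       = (\<Sum>(i, j)\<in>off_diag I. x i * a i j * x j)
         + m * (\<Sum>i\<in>I. (\<Sum>j\<in>I - {i}. a i j + a j i) * x i) + m\<^sup>2 * (\<Sum>(i, j)\<in>off_diag I. a i j)"
proof -
  have "(\<Sum>i\<in>I. (\<Sum>j\<in>I - {i}. a i j + a j i) * x i)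
      = (\<Sum>(i, j)\<in>off_diag I. a i j * x i) + (\<Sum>(i, j)\<in>off_diag I. a j i * x i)"
    using assms by (simp add: sum_off_diag sum.distrib[symmetric] sum_distrib_right sum_distrib_left algebra_simps)
  also have "(\<Sum>(i, j)\<in>off_diag I. a j i * x i) = (\<Sum>(i, j)\<in>off_diag I. a i j * x j)"
    by (rule sum_off_diag_swap)
  finally have lin: "(\<Sum>i\<in>I. (\<Sum>j\<in>I - {i}. a i j + a j i) * x i)
    = (\<Sum>(i, j)\<in>off_diag I. a i j * x i) + (\<Sum>(i, j)\<in>off_diag I. a i j * x j)" .
  show ?thesis unfolding lin
    by (simp add: sum_distrib_left sum.distrib[symmetric] case_prod_unfold power2_eq_square algebra_simps)
qed

context prob_space
begin

section \<open>Moments of forms in independent centred variables\<close>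

lemma indep_var_of_others:
  assumes "indep_vars (\<lambda>_. borel) X I" "i \<in> I" "J \<subseteq> I" "i \<notin> J"
    and g: "g \<in> borel_measurable (\<Pi>\<^sub>M j\<in>J. borel)" and Z: "\<And>\<omega>. Z \<omega> = g (\<lambda>j\<in>J. X j \<omega>)"
  shows "indep_var borel (X i) borel Z"
proof -
  have "indep_var borel ((\<lambda>x. x i) \<circ> (\<lambda>\<omega>. \<lambda>j\<in>{i}. X j \<omega>)) borel (g \<circ> (\<lambda>\<omega>. \<lambda>j\<in>J. X j \<omega>))"
    using assms(2-4) by (intro indep_var_compose[OF indep_var_restrict[OF assms(1)]] g) auto
  then show ?thesis by (simp add: comp_def Z[symmetric])
qed

text \<open>Here the factor \<open>L\<close> of the increment is the constant \<open>b i\<close>, with \<open>p\<close>-th moment exactly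
  \<open>((b i)\<^sup>2)\<^sup>r\<^sup>+\<^sup>1\<close>, which explains the last argument \<open>1\<close> of the constant.\<close>
lemma linear_form_moment:
  fixes X :: "'i \<Rightarrow> 'a \<Rightarrow> real" and b :: "'i \<Rightarrow> real" and r :: nat
  defines "p \<equiv> 2 * r + 2"
  assumes indep: "indep_vars (\<lambda>_. borel) X I" and "finite I"
    and X: "\<And>i. i \<in> I \<Longrightarrow> integrable M (\<lambda>\<omega>. X i \<omega> ^ p)" "\<And>i. i \<in> I \<Longrightarrow> expectation (X i) = 0"
      "\<And>i. i \<in> I \<Longrightarrow> expectation (\<lambda>\<omega>. X i \<omega> ^ p) \<le> K"
  shows "integrable M (\<lambda>\<omega>. (\<Sum>i\<in>I. b i * X i \<omega>) ^ p)
    \<and> expectation (\<lambda>\<omega>. (\<Sum>i\<in>I. b i * X i \<omega>) ^ p) \<le> increment_const r K 1 * (\<Sum>i\<in>I. (b i)\<^sup>2) ^ (r + 1)"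
  using \<open>finite I\<close> subset_refl[of I]
proof (induction rule: finite_subset_induct')
  case empty
  then show ?case by (simp add: p_def)
next
  case (insert i J)
  have [measurable]: "X j \<in> borel_measurable M" if "j \<in> I" for j
    using indep that by (auto simp: indep_vars_def)
  have [measurable]: "j \<in> J \<Longrightarrow> X j \<in> borel_measurable M" for j using insert by auto
  have split: "(\<Sum>i\<in>insert i J. b i * X i \<omega>) = (\<Sum>i\<in>J. b i * X i \<omega>) + X i \<omega> * b i"
    "(\<Sum>i\<in>insert i J. (b i)\<^sup>2) = (\<Sum>i\<in>J. (b i)\<^sup>2) + (b i)\<^sup>2" for \<omega>
    using insert by simp_all
  have "indep_var borel (X i) borel (\<lambda>\<omega>. h (\<Sum>i\<in>J. b i * X i \<omega>, b i))"
    if [measurable]: "h \<in> borel_measurable (borel \<Otimes>\<^sub>M borel)" for h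
    by (rule indep_var_of_others[OF indep, where J = J and g = "\<lambda>x. h (\<Sum>i\<in>J. b i * x i, b i)"])
       (use insert in \<open>auto cong: sum.cong\<close>)
  moreover have "b i ^ p = ((b i)\<^sup>2) ^ (r + 1)"
    by (simp only: power_mult[symmetric] p_def) simp
  ultimately show ?case unfolding split p_def
    using insert X[OF \<open>i \<in> I\<close>]
    by (intro conjI moment_add_independent_increment[where C = 1]) (auto simp: p_def prob_space sum_nonneg)
qed

text \<open>Adding the index \<open>i\<close> to \<open>J\<close> produces the increment \<open>X\<^sub>i L\<close> with the linear form
  \<open>L = (\<Sum>j\<in>J. (a\<^sub>i\<^sub>j + a\<^sub>j\<^sub>i) X\<^sub>j)\<close>, whose moments are already under control. The factor \<open>2\<close> in the size of
  the form comes from \<open>(x + y)\<^sup>2 \<le> 2 (x\<^sup>2 + y\<^sup>2)\<close>, applied to the coefficients of \<open>L\<close>.\<close>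
lemma off_diag_form_moment:
  fixes X :: "'i \<Rightarrow> 'a \<Rightarrow> real" and a :: "'i \<Rightarrow> 'i \<Rightarrow> real" and r :: nat
  defines "p \<equiv> 2 * r + 2"
  assumes indep: "indep_vars (\<lambda>_. borel) X I" and "finite I" and "0 \<le> K"
    and X: "\<And>i. i \<in> I \<Longrightarrow> integrable M (\<lambda>\<omega>. X i \<omega> ^ p)" "\<And>i. i \<in> I \<Longrightarrow> expectation (X i) = 0"
      "\<And>i. i \<in> I \<Longrightarrow> expectation (\<lambda>\<omega>. X i \<omega> ^ p) \<le> K"
  shows "integrable M (\<lambda>\<omega>. (\<Sum>(i, j)\<in>off_diag I. X i \<omega> * a i j * X j \<omega>) ^ p)
    \<and> expectation (\<lambda>\<omega>. (\<Sum>(i, j)\<in>off_diag I. X i \<omega> * a i j * X j \<omega>) ^ p)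
       \<le> increment_const r K (increment_const r K 1) * (2 * (\<Sum>(i, j)\<in>off_diag I. (a i j)\<^sup>2)) ^ (r + 1)"
  using \<open>finite I\<close> subset_refl[of I]
proof (induction rule: finite_subset_induct')
  case empty
  then show ?case by (simp add: p_def off_diag_def)
next
  case (insert i J)
  define L where "L \<omega> = (\<Sum>j\<in>J. (a i j + a j i) * X j \<omega>)" for \<omega>
  define f where "f = 2 * (\<Sum>j\<in>J. (a i j)\<^sup>2 + (a j i)\<^sup>2)"
  have [measurable]: "X j \<in> borel_measurable M" if "j \<in> I" for j
    using indep that by (auto simp: indep_vars_def)
  have [measurable]: "j \<in> J \<Longrightarrow> X j \<in> borel_measurable M" for j using insert by auto
  have J: "finite J" "i \<notin> J" "J \<subseteq> I" using insert by auto
  have C: "0 \<le> increment_const r K 1"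
    using increment_const_absorbs(1)[OF \<open>0 \<le> K\<close>] by simp
  have split: "(\<Sum>(i, j)\<in>off_diag (insert i J). X i \<omega> * a i j * X j \<omega>)
      = (\<Sum>(i, j)\<in>off_diag J. X i \<omega> * a i j * X j \<omega>) + X i \<omega> * L \<omega>"
    "2 * (\<Sum>(i, j)\<in>off_diag (insert i J). (a i j)\<^sup>2) = 2 * (\<Sum>(i, j)\<in>off_diag J. (a i j)\<^sup>2) + f" for \<omega>
    unfolding sum_off_diag_insert[OF J(1,2)] L_def f_def
    by (simp_all add: sum_distrib_left sum.distrib algebra_simps)
  have ind: "indep_var borel (X i) borel (\<lambda>\<omega>. h (\<Sum>(i, j)\<in>off_diag J. X i \<omega> * a i j * X j \<omega>, L \<omega>))"
    if [measurable]: "h \<in> borel_measurable (borel \<Otimes>\<^sub>M borel)" for h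
  proof (rule indep_var_of_others[OF indep])
    show "(\<lambda>x. h (\<Sum>(i, j)\<in>off_diag J. x i * a i j * x j, \<Sum>j\<in>J. (a i j + a j i) * x j))
        \<in> borel_measurable (\<Pi>\<^sub>M j\<in>J. borel)"
      by (auto simp: off_diag_def case_prod_unfold)
    show "h (\<Sum>(i, j)\<in>off_diag J. X i \<omega> * a i j * X j \<omega>, L \<omega>)
        = h (\<Sum>(k, j)\<in>off_diag J. (\<lambda>j\<in>J. X j \<omega>) k * a k j * (\<lambda>j\<in>J. X j \<omega>) j,
             \<Sum>j\<in>J. (a i j + a j i) * (\<lambda>j\<in>J. X j \<omega>) j)" for \<omega>
      unfolding L_def by (intro arg_cong[of _ _ h] arg_cong2[of _ _ _ _ Pair] sum.cong) (auto simp: off_diag_def)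
  qed (use insert in auto)
  have lin: "integrable M (\<lambda>\<omega>. L \<omega> ^ p)"
    "expectation (\<lambda>\<omega>. L \<omega> ^ p) \<le> increment_const r K 1 * (\<Sum>j\<in>J. (a i j + a j i)\<^sup>2) ^ (r + 1)"
    using linear_form_moment[of X J r K "\<lambda>j. a i j + a j i"] X J indep_vars_subset[OF indep J(3)]
    unfolding L_def p_def by auto
  have "(\<Sum>j\<in>J. (a i j + a j i)\<^sup>2) \<le> f"
    unfolding f_def sum_distrib_left by (intro sum_mono power2_sum_le)
  then have Lf: "expectation (\<lambda>\<omega>. L \<omega> ^ p) \<le> increment_const r K 1 * f ^ (r + 1)"
    using C by (intro order_trans[OF lin(2)] mult_left_mono power_mono) (auto intro: sum_nonneg)
  have [measurable]: "L \<in> borel_measurable M"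
      "(\<lambda>\<omega>. \<Sum>(i, j)\<in>off_diag J. X i \<omega> * a i j * X j \<omega>) \<in> borel_measurable M"
    unfolding L_def by (auto simp: off_diag_def case_prod_unfold)
  have "0 \<le> f" "0 \<le> 2 * (\<Sum>(i, j)\<in>off_diag J. (a i j)\<^sup>2)"
    by (auto simp: f_def case_prod_unfold intro!: sum_nonneg)
  note step = moment_add_independent_increment[where X = "X i" and r = r and K = K and L = L and f = f
      and Q = "\<lambda>\<omega>. \<Sum>(i, j)\<in>off_diag J. X i \<omega> * a i j * X j \<omega>"
      and F = "2 * (\<Sum>(i, j)\<in>off_diag J. (a i j)\<^sup>2)" and C = "increment_const r K 1", folded p_def]
  show ?case unfolding split
    by (intro conjI step ind X C Lf lin(1) insert.IH[THEN conjunct1] insert.IH[THEN conjunct2]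
         \<open>0 \<le> f\<close> \<open>0 \<le> 2 * (\<Sum>(i, j)\<in>off_diag J. (a i j)\<^sup>2)\<close>)
       (use \<open>i \<in> I\<close> in auto)
qed

end

section \<open>Forms in independent variables with a common mean\<close>

lemma le_one_plus_square: "x \<le> 1 + x\<^sup>2" for x :: real
proof -
  have "2 * x \<le> 1 + x\<^sup>2" using sum_squares_bound[of 1 x] by simp
  then show ?thesis using zero_le_power2[of x] by linarith
qed

lemma power_sum3_le:
  fixes u v w :: real
  assumes "even p"
  shows "(u + v + w) ^ p \<le> 3 ^ p * (u ^ p + v ^ p + w ^ p)"
proof -
  define m where "m = max \<bar>u\<bar> (max \<bar>v\<bar> \<bar>w\<bar>)"
  have "(u + v + w) ^ p = \<bar>u + v + w\<bar> ^ p" using assms by (simp add: power_even_abs)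
  also have "\<dots> \<le> (3 * m) ^ p" by (intro power_mono) (auto simp: m_def)
  also have "\<dots> = 3 ^ p * m ^ p" by (simp add: power_mult_distrib)
  also have "m ^ p \<le> u ^ p + v ^ p + w ^ p"
    using assms by (auto simp: m_def max_def power_even_abs zero_le_even_power add_nonneg_nonneg)
  finally show ?thesis by simp
qed

lemma cmod_power_le:
  "cmod z ^ (2 * r + 2) \<le> 2 ^ (r + 1) * (Re z ^ (2 * r + 2) + Im z ^ (2 * r + 2))"
proof -
  define m where "m = max ((Re z)\<^sup>2) ((Im z)\<^sup>2)"
  have e: "x ^ (2 * r + 2) = (x\<^sup>2) ^ (r + 1)" for x :: real
    by (simp only: power_mult[symmetric]) simp
  have "((Re z)\<^sup>2 + (Im z)\<^sup>2) ^ (r + 1) \<le> (2 * m) ^ (r + 1)"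
    by (intro power_mono) (auto simp: m_def)
  also have "\<dots> = 2 ^ (r + 1) * m ^ (r + 1)" by (rule power_mult_distrib)
  also have "m ^ (r + 1) \<le> ((Re z)\<^sup>2) ^ (r + 1) + ((Im z)\<^sup>2) ^ (r + 1)"
    unfolding m_def max_def by (simp del: power_Suc)
  finally show ?thesis unfolding e cmod_power2 by simp
qed

context prob_space
begin

lemma expectation_power_sum3:
  assumes [measurable]: "u \<in> borel_measurable M" "v \<in> borel_measurable M" and "even p"
    and int: "integrable M (\<lambda>\<omega>. u \<omega> ^ p)" "integrable M (\<lambda>\<omega>. v \<omega> ^ p)"
  shows "integrable M (\<lambda>\<omega>. (u \<omega> + v \<omega> + w) ^ p)"
    and "expectation (\<lambda>\<omega>. (u \<omega> + v \<omega> + w) ^ p)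
      \<le> 3 ^ p * (expectation (\<lambda>\<omega>. u \<omega> ^ p) + expectation (\<lambda>\<omega>. v \<omega> ^ p) + (w::real) ^ p)"
proof -
  have int3: "integrable M (\<lambda>\<omega>. 3 ^ p * (u \<omega> ^ p + v \<omega> ^ p + w ^ p))" using int by simp
  show *: "integrable M (\<lambda>\<omega>. (u \<omega> + v \<omega> + w) ^ p)"
  proof (rule Bochner_Integration.integrable_bound[OF int3])
    show "AE \<omega> in M. norm ((u \<omega> + v \<omega> + w) ^ p) \<le> norm (3 ^ p * (u \<omega> ^ p + v \<omega> ^ p + w ^ p))"
      using power_sum3_le[OF \<open>even p\<close>] \<open>even p\<close>
      by (intro AE_I2) (simp only: real_norm_def abs_of_nonneg[OF zero_le_even_power] order_trans[OF _ abs_ge_self])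
  qed auto
  have "expectation (\<lambda>\<omega>. (u \<omega> + v \<omega> + w) ^ p) \<le> expectation (\<lambda>\<omega>. 3 ^ p * (u \<omega> ^ p + v \<omega> ^ p + w ^ p))"
    by (intro integral_mono * int3 power_sum3_le \<open>even p\<close>)
  also have "\<dots> = 3 ^ p * (expectation (\<lambda>\<omega>. u \<omega> ^ p) + expectation (\<lambda>\<omega>. v \<omega> ^ p) + w ^ p)"
    using int by (simp add: prob_space)
  finally show "expectation (\<lambda>\<omega>. (u \<omega> + v \<omega> + w) ^ p)
      \<le> 3 ^ p * (expectation (\<lambda>\<omega>. u \<omega> ^ p) + expectation (\<lambda>\<omega>. v \<omega> ^ p) + w ^ p)" .
qed

text \<open>Markov's inequality for the power \<open>2 r + 2\<close> of the modulus; real and imaginary parts are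
  estimated separately.\<close>
lemma complex_tail_bound:
  fixes F :: "'a \<Rightarrow> complex"
  assumes [measurable]: "F \<in> borel_measurable M"
    and Re: "integrable M (\<lambda>\<omega>. Re (F \<omega>) ^ (2 * r + 2))" "expectation (\<lambda>\<omega>. Re (F \<omega>) ^ (2 * r + 2)) \<le> c * S ^ (r + 1)"
    and Im: "integrable M (\<lambda>\<omega>. Im (F \<omega>) ^ (2 * r + 2))" "expectation (\<lambda>\<omega>. Im (F \<omega>) ^ (2 * r + 2)) \<le> c * S ^ (r + 1)"
    and "0 \<le> c" "0 < S" "0 < h"
  shows "prob {\<omega> \<in> space M. cmod (F \<omega>) > h * sqrt S} \<le> 2 ^ (r + 2) * c / h ^ (2 * r + 2)"
proof -
  let ?p = "2 * r + 2"
  have int: "integrable M (\<lambda>\<omega>. 2 ^ (r + 1) * (Re (F \<omega>) ^ ?p + Im (F \<omega>) ^ ?p))" using Re Im by simp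
  have intF: "integrable M (\<lambda>\<omega>. cmod (F \<omega>) ^ ?p)"
  proof (rule Bochner_Integration.integrable_bound[OF int])
    show "AE \<omega> in M. norm (cmod (F \<omega>) ^ ?p) \<le> norm (2 ^ (r + 1) * (Re (F \<omega>) ^ ?p + Im (F \<omega>) ^ ?p))"
      unfolding real_norm_def
      by (intro AE_I2)
         (simp only: abs_of_nonneg[OF zero_le_power[OF norm_ge_zero]] order_trans[OF cmod_power_le abs_ge_self])
  qed auto
  have "expectation (\<lambda>\<omega>. cmod (F \<omega>) ^ ?p) \<le> expectation (\<lambda>\<omega>. 2 ^ (r + 1) * (Re (F \<omega>) ^ ?p + Im (F \<omega>) ^ ?p))"
    by (intro integral_mono intF int cmod_power_le)
  also have "\<dots> \<le> 2 ^ (r + 1) * (c * S ^ (r + 1) + c * S ^ (r + 1))"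
    using Re Im by (simp del: power_Suc)
  finally have E: "expectation (\<lambda>\<omega>. cmod (F \<omega>) ^ ?p) \<le> 2 ^ (r + 2) * c * S ^ (r + 1)"
    by (simp add: ac_simps)
  have pw: "(h * sqrt S) ^ ?p = h ^ ?p * S ^ (r + 1)"
  proof -
    have "sqrt S ^ (2 * (r + 1)) = S ^ (r + 1)" using \<open>0 < S\<close> by (simp only: power_mult) simp
    then show ?thesis by (simp add: power_mult_distrib)
  qed
  have "prob {\<omega> \<in> space M. cmod (F \<omega>) > h * sqrt S} \<le> prob {\<omega> \<in> space M. cmod (F \<omega>) ^ ?p \<ge> (h * sqrt S) ^ ?p}"
    using \<open>0 < S\<close> \<open>0 < h\<close> by (intro finite_measure_mono) (auto intro!: power_mono simp del: power_Suc simp: mult_nonneg_nonneg)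
  also have "\<dots> \<le> expectation (\<lambda>\<omega>. cmod (F \<omega>) ^ ?p) / (h * sqrt S) ^ ?p"
    using \<open>0 < S\<close> \<open>0 < h\<close> by (intro integral_Markov_inequality_measure[OF intF]) (auto intro!: zero_less_power)
  also have "\<dots> \<le> (2 ^ (r + 2) * c * S ^ (r + 1)) / (h * sqrt S) ^ ?p"
    using \<open>0 < S\<close> \<open>0 < h\<close> by (intro divide_right_mono E) auto
  also have "\<dots> = 2 ^ (r + 2) * c / h ^ ?p"
    unfolding pw using \<open>0 < S\<close> by simp
  finally show ?thesis .
qed

end

text \<open>The three summands pay for the powers of the mean, for a centred linear form and for a centred
  off-diagonal form; the factor in front comes from \<open>power_sum3_le\<close>.\<close>
definition form_const :: "nat \<Rightarrow> real \<Rightarrow> real" where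
  "form_const r K = 3 ^ (2 * r + 2) * (1 + 4 ^ (r + 1) * increment_const r K 1
     + 2 ^ (r + 1) * increment_const r K (increment_const r K 1))"

lemma form_const_nonneg: "0 \<le> K \<Longrightarrow> 0 \<le> form_const r K"
  unfolding form_const_def
  by (intro mult_nonneg_nonneg add_nonneg_nonneg increment_const_absorbs(1)) auto

text \<open>The common mean \<open>m\<close> is kept separate because it is small only on average over the mixing
  parameter. The number \<open>n\<close> is an upper bound for the number of variables; only the product
  \<open>n m\<^sup>2\<close> enters the estimates, through \<open>mean_scale\<close>.\<close>
locale independent_sample = prob_space M for M :: "'a measure" +
  fixes Z :: "'i \<Rightarrow> 'a \<Rightarrow> real" and I :: "'i set" and m K :: real and n r :: nat
  assumes indep: "indep_vars (\<lambda>_. borel) Z I" and finite_I: "finite I" and card_I: "card I \<le> n"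
    and K_nonneg: "0 \<le> K"
    and integrable_central: "\<And>i. i \<in> I \<Longrightarrow> integrable M (\<lambda>\<omega>. (Z i \<omega> - m) ^ (2 * r + 2))"
    and mean: "\<And>i. i \<in> I \<Longrightarrow> expectation (\<lambda>\<omega>. Z i \<omega> - m) = 0"
    and central_moment: "\<And>i. i \<in> I \<Longrightarrow> expectation (\<lambda>\<omega>. (Z i \<omega> - m) ^ (2 * r + 2)) \<le> K"
begin

abbreviation "X i \<omega> \<equiv> Z i \<omega> - m"

abbreviation "mean_scale \<equiv> (real n * m\<^sup>2) ^ (r + 1)"

lemma measurable_Z [measurable]: "i \<in> I \<Longrightarrow> Z i \<in> borel_measurable M"
  using indep by (auto simp: indep_vars_def)

lemma indep_X: "indep_vars (\<lambda>_. borel) X I"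
  by (rule indep_vars_compose2[OF indep]) auto

lemma central_linear_form:
  "integrable M (\<lambda>\<omega>. (\<Sum>i\<in>I. b i * X i \<omega>) ^ (2 * r + 2))"
  "expectation (\<lambda>\<omega>. (\<Sum>i\<in>I. b i * X i \<omega>) ^ (2 * r + 2))
     \<le> increment_const r K 1 * (\<Sum>i\<in>I. (b i)\<^sup>2) ^ (r + 1)"
  using linear_form_moment[OF indep_X finite_I integrable_central mean central_moment, of b] by auto

text \<open>In \<open>(\<Sum>i\<in>I. b i * X i) + m * (\<Sum>i\<in>I. b i)\<close> the square of the second sum is at most
  \<open>n m\<^sup>2 (\<Sum>i\<in>I. (b i)\<^sup>2)\<close>.\<close>
lemma linear_form_real:
  fixes b :: "'i \<Rightarrow> real"
  shows "integrable M (\<lambda>\<omega>. (\<Sum>i\<in>I. b i * Z i \<omega>) ^ (2 * r + 2))"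
    and "expectation (\<lambda>\<omega>. (\<Sum>i\<in>I. b i * Z i \<omega>) ^ (2 * r + 2))
      \<le> form_const r K * (1 + mean_scale\<^sup>2) * (\<Sum>i\<in>I. (b i)\<^sup>2) ^ (r + 1)"
proof -
  let ?p = "2 * r + 2" and ?S = "\<Sum>i\<in>I. (b i)\<^sup>2" and ?D = "increment_const r K 1"
  have split: "(\<Sum>i\<in>I. b i * Z i \<omega>) = (\<Sum>i\<in>I. b i * X i \<omega>) + 0 + m * (\<Sum>i\<in>I. b i)" for \<omega>
    by (simp add: algebra_simps sum_subtractf sum_distrib_left)
  note bound = expectation_power_sum3[where u = "\<lambda>\<omega>. \<Sum>i\<in>I. b i * X i \<omega>" and v = "\<lambda>_. 0"
      and w = "m * (\<Sum>i\<in>I. b i)" and p = ?p]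
  show "integrable M (\<lambda>\<omega>. (\<Sum>i\<in>I. b i * Z i \<omega>) ^ ?p)"
    unfolding split by (rule bound) (use central_linear_form in auto)
  have "(m * (\<Sum>i\<in>I. b i)) ^ ?p = (m\<^sup>2 * (\<Sum>i\<in>I. b i)\<^sup>2) ^ (r + 1)"
    by (simp only: power_mult_distrib power_mult[symmetric]) simp
  also have "\<dots> \<le> (m\<^sup>2 * (?S * n)) ^ (r + 1)"
    using card_I by (intro power_mono mult_left_mono order_trans[OF sum_squared_le_sum_of_squares] mult_nonneg_nonneg)
      (auto intro: sum_nonneg)
  also have "\<dots> = mean_scale * ?S ^ (r + 1)"
    by (simp add: power_mult_distrib algebra_simps)
  finally have mean_part: "(m * (\<Sum>i\<in>I. b i)) ^ ?p \<le> mean_scale * ?S ^ (r + 1)" .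
  have D: "0 \<le> ?D" "0 \<le> increment_const r K ?D"
    by (intro increment_const_absorbs(1) K_nonneg; simp)+
  have "expectation (\<lambda>\<omega>. (\<Sum>i\<in>I. b i * Z i \<omega>) ^ ?p)
      \<le> 3 ^ ?p * (expectation (\<lambda>\<omega>. (\<Sum>i\<in>I. b i * X i \<omega>) ^ ?p) + expectation (\<lambda>\<omega>. 0 ^ ?p)
          + (m * (\<Sum>i\<in>I. b i)) ^ ?p)"
    unfolding split by (rule bound) (use central_linear_form in auto)
  also have "\<dots> \<le> 3 ^ ?p * (?D * ?S ^ (r + 1) + 0 + mean_scale * ?S ^ (r + 1))"
    by (intro mult_left_mono add_mono central_linear_form mean_part) auto
  also have "\<dots> = 3 ^ ?p * (?D + mean_scale) * ?S ^ (r + 1)" by (simp add: algebra_simps)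
  also have "\<dots> \<le> form_const r K * (1 + mean_scale\<^sup>2) * ?S ^ (r + 1)"
  proof (rule mult_right_mono)
    have "1 * ?D \<le> 4 ^ (r + 1) * ?D" by (intro mult_right_mono D one_le_power) simp
    moreover have "mean_scale \<le> 1 + mean_scale\<^sup>2"
      by (rule le_one_plus_square)
    moreover define A where "A = 4 ^ (r + 1) * ?D + 2 ^ (r + 1) * increment_const r K ?D"
    moreover have "0 \<le> 2 ^ (r + 1) * increment_const r K ?D" using D by simp
    ultimately have "?D + mean_scale \<le> A + (1 + mean_scale\<^sup>2)" "0 \<le> A" using D(1) by linarith+
    moreover from this(2) have "0 \<le> A * mean_scale\<^sup>2" by simp
    moreover have "(1 + A) * (1 + mean_scale\<^sup>2) = A + (1 + mean_scale\<^sup>2) + A * mean_scale\<^sup>2"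
      by (simp only: distrib_left distrib_right mult_1_left mult_1_right)
    ultimately have "?D + mean_scale \<le> (1 + A) * (1 + mean_scale\<^sup>2)" by linarith
    then have "3 ^ ?p * (?D + mean_scale) \<le> 3 ^ ?p * ((1 + A) * (1 + mean_scale\<^sup>2))"
      by (rule mult_left_mono) simp
    then show "3 ^ ?p * (?D + mean_scale) \<le> form_const r K * (1 + mean_scale\<^sup>2)"
      unfolding form_const_def A_def by (simp only: mult.assoc add.assoc)
  qed (rule zero_le_power, rule sum_nonneg, simp)
  finally show "expectation (\<lambda>\<omega>. (\<Sum>i\<in>I. b i * Z i \<omega>) ^ ?p)
      \<le> form_const r K * (1 + mean_scale\<^sup>2) * ?S ^ (r + 1)" .
qed

text \<open>Expanding around \<open>m\<close> gives a centred form, \<open>m\<close> times a linear form and \<open>m\<^sup>2\<close> times a constant,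
  with \<open>p\<close>-th moments of order \<open>1\<close>, \<open>mean_scale\<close> and \<open>mean_scale\<^sup>2\<close> relative to the size of the form.\<close>
lemma off_diag_form_real:
  fixes a :: "'i \<Rightarrow> 'i \<Rightarrow> real"
  shows "integrable M (\<lambda>\<omega>. (\<Sum>(i, j)\<in>off_diag I. Z i \<omega> * a i j * Z j \<omega>) ^ (2 * r + 2))"
    and "expectation (\<lambda>\<omega>. (\<Sum>(i, j)\<in>off_diag I. Z i \<omega> * a i j * Z j \<omega>) ^ (2 * r + 2))
      \<le> form_const r K * (1 + mean_scale\<^sup>2) * (\<Sum>(i, j)\<in>off_diag I. (a i j)\<^sup>2) ^ (r + 1)"
proof -
  let ?p = "2 * r + 2" and ?S = "\<Sum>(i, j)\<in>off_diag I. (a i j)\<^sup>2" and ?D = "increment_const r K 1"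
  let ?E = "increment_const r K ?D"
  define u where "u \<omega> = (\<Sum>(i, j)\<in>off_diag I. X i \<omega> * a i j * X j \<omega>)" for \<omega>
  define c where "c i = (\<Sum>j\<in>I - {i}. a i j + a j i)" for i
  define l where "l \<omega> = (\<Sum>i\<in>I. c i * X i \<omega>)" for \<omega>
  have [measurable]: "u \<in> borel_measurable M" "l \<in> borel_measurable M"
    unfolding u_def l_def by (auto simp: off_diag_def case_prod_unfold)
  have split: "(\<Sum>(i, j)\<in>off_diag I. Z i \<omega> * a i j * Z j \<omega>)
      = u \<omega> + m * l \<omega> + m\<^sup>2 * (\<Sum>(i, j)\<in>off_diag I. a i j)" for \<omega>
    using off_diag_form_shift[OF finite_I, of "\<lambda>i. X i \<omega>" m a] by (simp add: u_def l_def c_def)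
  have u: "integrable M (\<lambda>\<omega>. u \<omega> ^ ?p)" "expectation (\<lambda>\<omega>. u \<omega> ^ ?p) \<le> ?E * (2 * ?S) ^ (r + 1)"
    using off_diag_form_moment[OF indep_X finite_I K_nonneg integrable_central mean central_moment, of a]
    by (auto simp: u_def)
  have l: "integrable M (\<lambda>\<omega>. l \<omega> ^ ?p)" "expectation (\<lambda>\<omega>. l \<omega> ^ ?p) \<le> ?D * (\<Sum>i\<in>I. (c i)\<^sup>2) ^ (r + 1)"
    using central_linear_form[of c] by (auto simp: l_def)
  have S: "0 \<le> ?S" by (auto intro: sum_nonneg)
  have D: "0 \<le> ?D" "0 \<le> ?E" 
    by (intro increment_const_absorbs(1) K_nonneg; simp)+
  have "expectation (\<lambda>\<omega>. (m * l \<omega>) ^ ?p) = (m\<^sup>2) ^ (r + 1) * expectation (\<lambda>\<omega>. l \<omega> ^ ?p)"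
    by (simp only: power_mult_distrib power_mult[symmetric]) simp
  also have "\<dots> \<le> (m\<^sup>2) ^ (r + 1) * (?D * (4 * real n * ?S) ^ (r + 1))"
    using sum_squares_of_sums_off_diag_le[OF finite_I card_I, of a]
    by (intro mult_left_mono order_trans[OF l(2)] power_mono D) (auto simp: c_def intro: sum_nonneg)
  also have "\<dots> = 4 ^ (r + 1) * ?D * mean_scale * ?S ^ (r + 1)"
    by (simp only: power_mult_distrib ac_simps)
  finally have ml: "expectation (\<lambda>\<omega>. (m * l \<omega>) ^ ?p) \<le> 4 ^ (r + 1) * ?D * mean_scale * ?S ^ (r + 1)" .
  have "(\<Sum>(i, j)\<in>off_diag I. a i j)\<^sup>2 \<le> ?S * card (off_diag I)"
    using sum_squared_le_sum_of_squares[of "\<lambda>(i, j). a i j" "off_diag I"] by (simp add: case_prod_unfold)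
  also have "\<dots> \<le> ?S * (n * n)"
  proof (rule mult_left_mono[OF _ S])
    have "card (off_diag I) \<le> n * n"
      using card_off_diag_le[OF finite_I] mult_le_mono[OF card_I card_I] by linarith
    then show "real (card (off_diag I)) \<le> real (n * n)" by (rule of_nat_mono)
  qed
  finally have sq: "(\<Sum>(i, j)\<in>off_diag I. a i j)\<^sup>2 \<le> ?S * (n * n)" .
  have "(m\<^sup>2 * (\<Sum>(i, j)\<in>off_diag I. a i j)) ^ ?p = ((m\<^sup>2 * (\<Sum>(i, j)\<in>off_diag I. a i j))\<^sup>2) ^ (r + 1)"
    by (simp only: power_mult[symmetric]) simp
  also have "\<dots> = ((m\<^sup>2)\<^sup>2 * (\<Sum>(i, j)\<in>off_diag I. a i j)\<^sup>2) ^ (r + 1)"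
    by (simp only: power_mult_distrib)
  also have "\<dots> \<le> ((m\<^sup>2)\<^sup>2 * (?S * (n * n))) ^ (r + 1)"
    by (intro power_mono mult_left_mono sq) auto
  also have "\<dots> = mean_scale\<^sup>2 * ?S ^ (r + 1)"
    by (simp add: power_mult_distrib power2_eq_square algebra_simps)
  finally have mean_part: "(m\<^sup>2 * (\<Sum>(i, j)\<in>off_diag I. a i j)) ^ ?p \<le> mean_scale\<^sup>2 * ?S ^ (r + 1)" .
  note bound = expectation_power_sum3[where u = u and v = "\<lambda>\<omega>. m * l \<omega>"
      and w = "m\<^sup>2 * (\<Sum>(i, j)\<in>off_diag I. a i j)" and p = ?p]
  have ml_int: "integrable M (\<lambda>\<omega>. (m * l \<omega>) ^ ?p)"
    unfolding power_mult_distrib by (intro Bochner_Integration.integrable_mult_right l(1))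
  show "integrable M (\<lambda>\<omega>. (\<Sum>(i, j)\<in>off_diag I. Z i \<omega> * a i j * Z j \<omega>) ^ ?p)"
    unfolding split by (rule bound[OF _ _ _ u(1) ml_int]) auto
  have "expectation (\<lambda>\<omega>. (\<Sum>(i, j)\<in>off_diag I. Z i \<omega> * a i j * Z j \<omega>) ^ ?p)
      \<le> 3 ^ ?p * (expectation (\<lambda>\<omega>. u \<omega> ^ ?p) + expectation (\<lambda>\<omega>. (m * l \<omega>) ^ ?p)
          + (m\<^sup>2 * (\<Sum>(i, j)\<in>off_diag I. a i j)) ^ ?p)"
    unfolding split by (rule bound[OF _ _ _ u(1) ml_int]) auto
  also have "\<dots> \<le> 3 ^ ?p * (?E * (2 * ?S) ^ (r + 1) + 4 ^ (r + 1) * ?D * mean_scale * ?S ^ (r + 1)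
      + mean_scale\<^sup>2 * ?S ^ (r + 1))"
    by (intro mult_left_mono add_mono u(2) ml mean_part) auto
  also have "\<dots> = 3 ^ ?p * (2 ^ (r + 1) * ?E + 4 ^ (r + 1) * ?D * mean_scale + mean_scale\<^sup>2) * ?S ^ (r + 1)"
    by (simp only: power_mult_distrib algebra_simps)
  also have "\<dots> \<le> form_const r K * (1 + mean_scale\<^sup>2) * ?S ^ (r + 1)"
  proof (rule mult_right_mono)
    define A B where "A = 4 ^ (r + 1) * ?D" and "B = 2 ^ (r + 1) * ?E"
    have AB: "0 \<le> A" "0 \<le> B" using D by (auto simp: A_def B_def)
    have "mean_scale \<le> 1 + mean_scale\<^sup>2"
      by (rule le_one_plus_square)
    then have "A * mean_scale \<le> A * (1 + mean_scale\<^sup>2)" using AB(1) by (rule mult_left_mono)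
    moreover have "0 \<le> B * mean_scale\<^sup>2" using AB(2) by simp
    ultimately have "B + A * mean_scale + mean_scale\<^sup>2 \<le> (1 + A + B) * (1 + mean_scale\<^sup>2)"
      by (simp add: algebra_simps)
    then have "3 ^ ?p * (B + A * mean_scale + mean_scale\<^sup>2) \<le> 3 ^ ?p * ((1 + A + B) * (1 + mean_scale\<^sup>2))"
      by (rule mult_left_mono) simp
    then show "3 ^ ?p * (2 ^ (r + 1) * ?E + 4 ^ (r + 1) * ?D * mean_scale + mean_scale\<^sup>2)
        \<le> form_const r K * (1 + mean_scale\<^sup>2)"
      unfolding form_const_def A_def B_def by (simp only: mult.assoc add.assoc)
  qed (use S in simp)
  finally show "expectation (\<lambda>\<omega>. (\<Sum>(i, j)\<in>off_diag I. Z i \<omega> * a i j * Z j \<omega>) ^ ?p)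
      \<le> form_const r K * (1 + mean_scale\<^sup>2) * ?S ^ (r + 1)" .
qed

lemma linear_form_tail:
  fixes b :: "'i \<Rightarrow> complex"
  assumes "0 < h"
  shows "prob {\<omega> \<in> space M. cmod (\<Sum>i\<in>I. b i * complex_of_real (Z i \<omega>)) > h * sqrt (\<Sum>i\<in>I. (cmod (b i))\<^sup>2)}
    \<le> 2 ^ (r + 2) * (form_const r K * (1 + mean_scale\<^sup>2)) / h ^ (2 * r + 2)"
proof (cases "(\<Sum>i\<in>I. (cmod (b i))\<^sup>2) = 0")
  case True
  \<comment> \<open>Both sides of the inequality that defines the event are zero, so the event is empty.\<close>
  then have "b i = 0" if "i \<in> I" for i
    using that finite_I by (simp add: sum_nonneg_eq_0_iff)
  then show ?thesis using form_const_nonneg[OF K_nonneg, of r] assms by simp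
next
  case False
  let ?S = "\<Sum>i\<in>I. (cmod (b i))\<^sup>2"
  have S: "0 < ?S" using False by (metis sum_nonneg less_eq_real_def zero_le_power2)
  have c: "0 \<le> form_const r K * (1 + mean_scale\<^sup>2)"
    using form_const_nonneg[OF K_nonneg] by simp
  have part: "form_const r K * (1 + mean_scale\<^sup>2) * (\<Sum>i\<in>I. (g (b i))\<^sup>2) ^ (r + 1)
      \<le> form_const r K * (1 + mean_scale\<^sup>2) * ?S ^ (r + 1)" if "\<And>z. (g z)\<^sup>2 \<le> (cmod z)\<^sup>2" for g :: "complex \<Rightarrow> real"
    using that by (intro mult_left_mono[OF power_mono[OF sum_mono] c]) (auto intro: sum_nonneg)
  show ?thesis
  proof (rule complex_tail_bound[OF _ _ _ _ _ c S assms])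
    show "expectation (\<lambda>\<omega>. Re (\<Sum>i\<in>I. b i * complex_of_real (Z i \<omega>)) ^ (2 * r + 2))
        \<le> form_const r K * (1 + mean_scale\<^sup>2) * ?S ^ (r + 1)"
      using linear_form_real(2)[of "\<lambda>i. Re (b i)"] part[of Re] by (simp add: cmod_power2)
    show "expectation (\<lambda>\<omega>. Im (\<Sum>i\<in>I. b i * complex_of_real (Z i \<omega>)) ^ (2 * r + 2))
        \<le> form_const r K * (1 + mean_scale\<^sup>2) * ?S ^ (r + 1)"
      using linear_form_real(2)[of "\<lambda>i. Im (b i)"] part[of Im] by (simp add: cmod_power2)
  qed (use linear_form_real(1)[of "\<lambda>i. Re (b i)"] linear_form_real(1)[of "\<lambda>i. Im (b i)"] in simp_all)
qed

lemma off_diag_form_tail: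
  fixes a :: "'i \<Rightarrow> 'i \<Rightarrow> complex"
  assumes "0 < h"
  shows "prob {\<omega> \<in> space M. cmod (\<Sum>(i, j)\<in>off_diag I. complex_of_real (Z i \<omega>) * a i j * complex_of_real (Z j \<omega>))
      > h * sqrt (\<Sum>(i, j)\<in>off_diag I. (cmod (a i j))\<^sup>2)}
    \<le> 2 ^ (r + 2) * (form_const r K * (1 + mean_scale\<^sup>2)) / h ^ (2 * r + 2)"
proof (cases "(\<Sum>(i, j)\<in>off_diag I. (cmod (a i j))\<^sup>2) = 0")
  case True
  then have "a i j = 0" if "(i, j) \<in> off_diag I" for i j
    using that finite_off_diag[OF finite_I]
    by (subst (asm) sum_nonneg_eq_0_iff) (auto simp: case_prod_unfold)
  then have "(\<Sum>(i, j)\<in>off_diag I. complex_of_real (Z i \<omega>) * a i j * complex_of_real (Z j \<omega>)) = 0" for \<omega>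
    by (intro sum.neutral) auto
  then show ?thesis using form_const_nonneg[OF K_nonneg, of r] assms True by simp
next
  case False
  let ?S = "\<Sum>(i, j)\<in>off_diag I. (cmod (a i j))\<^sup>2"
  have "0 \<le> ?S" by (auto intro: sum_nonneg)
  with False have S: "0 < ?S" by linarith
  have c: "0 \<le> form_const r K * (1 + mean_scale\<^sup>2)"
    using form_const_nonneg[OF K_nonneg] by simp
  have part: "form_const r K * (1 + mean_scale\<^sup>2) * (\<Sum>(i, j)\<in>off_diag I. (g (a i j))\<^sup>2) ^ (r + 1)
      \<le> form_const r K * (1 + mean_scale\<^sup>2) * ?S ^ (r + 1)" if "\<And>z. (g z)\<^sup>2 \<le> (cmod z)\<^sup>2" for g :: "complex \<Rightarrow> real"
    using that by (intro mult_left_mono[OF power_mono[OF sum_mono] c]) (auto intro: sum_nonneg)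
  have parts: "Re (\<Sum>(i, j)\<in>off_diag I. complex_of_real (Z i \<omega>) * a i j * complex_of_real (Z j \<omega>))
      = (\<Sum>(i, j)\<in>off_diag I. Z i \<omega> * Re (a i j) * Z j \<omega>)"
    "Im (\<Sum>(i, j)\<in>off_diag I. complex_of_real (Z i \<omega>) * a i j * complex_of_real (Z j \<omega>))
      = (\<Sum>(i, j)\<in>off_diag I. Z i \<omega> * Im (a i j) * Z j \<omega>)" for \<omega>
    by (simp_all add: case_prod_unfold)
  show ?thesis
  proof (rule complex_tail_bound[OF _ _ _ _ _ c S assms])
    show "expectation (\<lambda>\<omega>. Re (\<Sum>(i, j)\<in>off_diag I. complex_of_real (Z i \<omega>) * a i j * complex_of_real (Z j \<omega>)) ^ (2 * r + 2))
        \<le> form_const r K * (1 + mean_scale\<^sup>2) * ?S ^ (r + 1)"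
      unfolding parts by (rule order_trans[OF off_diag_form_real(2)], rule part) (simp add: cmod_power2)
    show "expectation (\<lambda>\<omega>. Im (\<Sum>(i, j)\<in>off_diag I. complex_of_real (Z i \<omega>) * a i j * complex_of_real (Z j \<omega>)) ^ (2 * r + 2))
        \<le> form_const r K * (1 + mean_scale\<^sup>2) * ?S ^ (r + 1)"
      unfolding parts by (rule order_trans[OF off_diag_form_real(2)], rule part) (simp add: cmod_power2)
    show "(\<lambda>\<omega>. \<Sum>(i, j)\<in>off_diag I. complex_of_real (Z i \<omega>) * a i j * complex_of_real (Z j \<omega>)) \<in> borel_measurable M"
      by (auto simp: off_diag_def case_prod_unfold)
  qed (unfold parts, rule off_diag_form_real(1), rule off_diag_form_real(1))
qed

end

section \<open>Mixing over the parameter\<close>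

lemma sets_weak_borelI: "openin weak_topology U \<Longrightarrow> U \<in> sets weak_borel"
  unfolding weak_borel_def by (subst sets_measure_of) (auto dest: openin_subset)

lemma integral_measurable_weak_borel:
  fixes f :: "real \<Rightarrow> real"
  assumes "continuous_on UNIV f" "bounded (range f)"
  shows "(\<lambda>Q. \<integral>x. f x \<partial>Q) \<in> borel_measurable weak_borel"
proof (rule borel_measurableI)
  fix V :: "real set" assume "open V"
  have "openin weak_topology {Q \<in> borel_prob_measures. (\<integral>x. f x \<partial>Q) \<in> V}"
    unfolding weak_topology_def by (rule topology_generated_by_Basis) (use assms \<open>open V\<close> in blast)
  then show "(\<lambda>Q. \<integral>x. f x \<partial>Q) -` V \<inter> space weak_borel \<in> sets weak_borel"
    by (auto simp: space_weak_borel vimage_def Int_def conj_commute intro!: sets_weak_borelI)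
qed

lemma mixing_space_borel_prob:
  assumes "mixing_space \<mu> P" "t \<in> space \<mu>"
  shows "prob_space (P t)" "sets (P t) = sets borel"
  using measurable_space[of P \<mu> weak_borel t] assms
  by (auto simp: mixing_space_def space_weak_borel borel_prob_measures_def)

text \<open>For bounded continuous integrands this is the definition of the weak topology; the general case
  follows by truncation and dominated convergence.\<close>
lemma integral_measurable_mixing:
  fixes z :: "real \<Rightarrow> real"
  assumes mix: "mixing_space \<mu> P" and z: "continuous_on UNIV z"
    and int: "\<And>t. t \<in> space \<mu> \<Longrightarrow> integrable (P t) z"
  shows "(\<lambda>t. \<integral>x. z x \<partial>P t) \<in> borel_measurable \<mu>"
proof (rule borel_measurable_LIMSEQ_real)
  define f where "f n x = max (- real n) (min (real n) (z x))" for n x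
  have abs_f: "\<bar>f n x\<bar> \<le> real n" "\<bar>f n x\<bar> \<le> \<bar>z x\<bar>" for n x
    by (auto simp: f_def)
  show "(\<lambda>t. \<integral>x. f n x \<partial>P t) \<in> borel_measurable \<mu>" for n
  proof (rule measurable_compose[OF _ integral_measurable_weak_borel])
    show "P \<in> measurable \<mu> weak_borel" using mix by (simp add: mixing_space_def)
    show "continuous_on UNIV (f n)" unfolding f_def[abs_def] using z by (intro continuous_intros)
    show "bounded (range (f n))" unfolding bounded_iff using abs_f(1) by auto
  qed
  fix t assume t: "t \<in> space \<mu>"
  have [measurable_cong]: "sets (P t) = sets borel" using mixing_space_borel_prob[OF mix t] by simp
  have [measurable]: "z \<in> borel_measurable borel" using z by (rule borel_measurable_continuous_onI)
  show "(\<lambda>n. \<integral>x. f n x \<partial>P t) \<longlonglongrightarrow> (\<integral>x. z x \<partial>P t)"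
  proof (rule integral_dominated_convergence[where w = "\<lambda>x. \<bar>z x\<bar>"])
    show "AE x in P t. (\<lambda>n. f n x) \<longlonglongrightarrow> z x"
    proof (intro AE_I2 tendsto_eventually)
      fix x
      obtain n0 :: nat where "\<bar>z x\<bar> \<le> real n0" using real_arch_simple by blast
      then show "\<forall>\<^sub>F n in sequentially. f n x = z x"
        unfolding eventually_sequentially f_def by (intro exI[of _ n0]) auto
    qed
  qed (use int[OF t] abs_f(2) in \<open>auto simp: f_def[abs_def]\<close>)
qed

text \<open>Under the product measure the coordinates with index in \<open>I\<close> form an independent sample, and so
  do their images under \<open>z\<close>.\<close>
lemma independent_sample_PiM:
  fixes Q :: "real measure" and z :: "real \<Rightarrow> real"
  assumes "prob_space Q" and Q: "sets Q = sets borel" and "finite J" "I \<subseteq> J" "card I \<le> n" "0 \<le> K"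
    and z[measurable]: "z \<in> borel_measurable borel" and int: "integrable Q z"
    and moment: "(\<integral>\<^sup>+y. ennreal (\<bar>z y - (\<integral>x. z x \<partial>Q)\<bar> ^ (2 * r + 2)) \<partial>Q) \<le> ennreal K"
  shows "independent_sample (\<Pi>\<^sub>M i\<in>J. Q) (\<lambda>i x. z (x i)) I (\<integral>x. z x \<partial>Q) K n r"
proof -
  interpret Q: prob_space Q by fact
  interpret PJ: prob_space "\<Pi>\<^sub>M i\<in>J. Q" by (intro prob_space_PiM assms(1))
  let ?m = "\<integral>x. z x \<partial>Q" and ?p = "2 * r + 2"
  note [measurable_cong] = Q
  have zQ[measurable]: "z \<in> borel_measurable Q" by measurable
  have even: "\<bar>x\<bar> ^ ?p = x ^ ?p" for x :: real by (simp add: power_even_abs)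
  have int_p: "integrable Q (\<lambda>y. (z y - ?m) ^ ?p)"
    using moment by (intro integrableI_bounded) (auto simp: even[symmetric] power_abs less_top[symmetric] top_unique simp del: power_Suc intro: le_less_trans)
  have moment': "(\<integral>y. (z y - ?m) ^ ?p \<partial>Q) \<le> K"
  proof -
    have "ennreal (\<integral>y. (z y - ?m) ^ ?p \<partial>Q) = (\<integral>\<^sup>+y. ennreal ((z y - ?m) ^ ?p) \<partial>Q)"
      by (rule nn_integral_eq_integral[OF int_p, symmetric]) (intro AE_I2 zero_le_even_power, simp)
    also have "\<dots> \<le> ennreal K" using moment by (simp only: even)
    finally show ?thesis using \<open>0 \<le> K\<close> by (simp only: ennreal_le_iff)
  qed
  have distr: "distr (\<Pi>\<^sub>M i\<in>J. Q) Q (\<lambda>x. x i) = Q" if "i \<in> J" for i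
    using that by (intro distr_PiM_component) (auto intro: assms(1))
  have transfer: "integrable (\<Pi>\<^sub>M i\<in>J. Q) (\<lambda>x. g (x i)) = integrable Q g"
    "(\<integral>x. g (x i) \<partial>(\<Pi>\<^sub>M i\<in>J. Q)) = (\<integral>y. g y \<partial>Q)"
    if "i \<in> J" "g \<in> borel_measurable Q" for i and g :: "real \<Rightarrow> real"
    using that integrable_distr_eq[of "\<lambda>x. x i" "\<Pi>\<^sub>M i\<in>J. Q" Q g] integral_distr[of "\<lambda>x. x i" "\<Pi>\<^sub>M i\<in>J. Q" Q g]
    by (auto simp: distr)
  have "PJ.indep_vars (\<lambda>_. borel) (\<lambda>i x. z (x i)) I"
  proof (cases "J = {}")
    case True
    then have "I = {}" using \<open>I \<subseteq> J\<close> by simp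
    then show ?thesis by (simp add: PJ.indep_vars_def PJ.indep_sets_def)
  next
    case False
    have "PJ.indep_vars (\<lambda>_. Q) (\<lambda>i x. x i) J"
    proof (subst PJ.indep_vars_iff_distr_eq_PiM'[OF False])
      have "distr (\<Pi>\<^sub>M i\<in>J. Q) (\<Pi>\<^sub>M i\<in>J. Q) (\<lambda>x. \<lambda>i\<in>J. x i) = distr (\<Pi>\<^sub>M i\<in>J. Q) (\<Pi>\<^sub>M i\<in>J. Q) (\<lambda>x. x)"
        by (intro distr_cong) (auto simp: space_PiM restrict_PiE_iff PiE_restrict)
      also have "\<dots> = (\<Pi>\<^sub>M i\<in>J. distr (\<Pi>\<^sub>M i\<in>J. Q) Q (\<lambda>x. x i))"
        by (simp add: distr_id cong: PiM_cong) (intro PiM_cong, auto simp: distr)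
      finally show "distr (\<Pi>\<^sub>M i\<in>J. Q) (\<Pi>\<^sub>M i\<in>J. Q) (\<lambda>x. \<lambda>i\<in>J. x i) = (\<Pi>\<^sub>M i\<in>J. distr (\<Pi>\<^sub>M i\<in>J. Q) Q (\<lambda>x. x i))" .
    qed auto
    then have "PJ.indep_vars (\<lambda>_. borel) (\<lambda>i x. z (x i)) J"
      by (rule PJ.indep_vars_compose2) auto
    then show ?thesis using \<open>I \<subseteq> J\<close> by (rule PJ.indep_vars_subset)
  qed
  moreover have "integrable (\<Pi>\<^sub>M i\<in>J. Q) (\<lambda>x. (z (x i) - ?m) ^ ?p)"
      "(\<integral>x. z (x i) - ?m \<partial>(\<Pi>\<^sub>M i\<in>J. Q)) = 0" "(\<integral>x. (z (x i) - ?m) ^ ?p \<partial>(\<Pi>\<^sub>M i\<in>J. Q)) \<le> K"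
    if "i \<in> I" for i
    using that \<open>I \<subseteq> J\<close> int_p moment' int
      transfer[of i "\<lambda>y. (z y - ?m) ^ ?p"] transfer[of i "\<lambda>y. z y - ?m"]
    by (auto simp: Q.prob_space)
  ultimately show ?thesis
    using assms(3-6) by unfold_locales (auto intro: finite_subset)
qed

text \<open>The de-Finetti representation turns the probability into a \<open>\<mu>\<close>-integral over product measures,
  and Fubini's theorem freezes the coordinates in \<open>K\<close>; the disjoint coordinates keep their law. The
  bound \<open>g\<close> may depend on \<open>t\<close> but not on the frozen values.\<close>
lemma de_Finetti_conditional_bound:
  fixes Y :: "'i \<Rightarrow> 'w \<Rightarrow> real" and \<Phi> :: "('i \<Rightarrow> real) \<Rightarrow> ('i \<Rightarrow> real) \<Rightarrow> bool"
  assumes dF: "de_Finetti_type M W Y \<mu> P" and "finite W" "K \<subseteq> W"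
    and [measurable]: "Measurable.pred ((\<Pi>\<^sub>M i\<in>K. borel) \<Otimes>\<^sub>M (\<Pi>\<^sub>M i\<in>W - K. borel)) (\<lambda>(v, w). \<Phi> v w)"
    and bound: "\<And>t v. t \<in> space \<mu> \<Longrightarrow> v \<in> space (\<Pi>\<^sub>M i\<in>K. (borel :: real measure)) \<Longrightarrow>
      emeasure (\<Pi>\<^sub>M i\<in>W - K. P t) {w \<in> space (\<Pi>\<^sub>M i\<in>W - K. P t). \<Phi> v w} \<le> g t"
  shows "emeasure M {\<omega> \<in> space M. \<Phi> (subtuple Y K \<omega>) (subtuple Y (W - K) \<omega>)} \<le> (\<integral>\<^sup>+t. g t \<partial>\<mu>)"
proof -
  let ?L = "W - K"
  define B where "B = {x \<in> space (\<Pi>\<^sub>M i\<in>W. (borel :: real measure)). \<Phi> (restrict x K) (restrict x ?L)}"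
  have pairs: "(\<lambda>x. (restrict x K, restrict x ?L)) \<in> measurable (\<Pi>\<^sub>M i\<in>W. borel) ((\<Pi>\<^sub>M i\<in>K. borel) \<Otimes>\<^sub>M (\<Pi>\<^sub>M i\<in>?L. (borel :: real measure)))"
    using \<open>K \<subseteq> W\<close> by (intro measurable_Pair measurable_restrict_subset) auto
  have B: "B \<in> sets (\<Pi>\<^sub>M i\<in>W. borel)"
    using measurable_compose[OF pairs assms(4)] by (simp add: B_def pred_def)
  have "{\<omega> \<in> space M. \<Phi> (subtuple Y K \<omega>) (subtuple Y ?L \<omega>)} = {\<omega> \<in> space M. subtuple Y W \<omega> \<in> B}"
  proof -
    have "restrict (subtuple Y W \<omega>) K = subtuple Y K \<omega>" "restrict (subtuple Y W \<omega>) ?L = subtuple Y ?L \<omega>"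
      "subtuple Y W \<omega> \<in> space (\<Pi>\<^sub>M i\<in>W. (borel :: real measure))" for \<omega>
      using \<open>K \<subseteq> W\<close> by (auto simp: subtuple_def space_PiM fun_eq_iff)
    then show ?thesis by (simp add: B_def)
  qed
  then have "emeasure M {\<omega> \<in> space M. \<Phi> (subtuple Y K \<omega>) (subtuple Y ?L \<omega>)}
      = (\<integral>\<^sup>+t. emeasure (\<Pi>\<^sub>M i\<in>W. P t) B \<partial>\<mu>)"
    using dF B by (simp add: de_Finetti_type_def)
  also have "\<dots> \<le> (\<integral>\<^sup>+t. g t \<partial>\<mu>)"
  proof (rule nn_integral_mono)
    fix t assume t: "t \<in> space \<mu>"
    have mix: "mixing_space \<mu> P" using dF by (simp add: de_Finetti_type_def)
    note Q = mixing_space_borel_prob[OF mix t]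
    interpret prob_space "P t" by (rule Q)
    interpret product_sigma_finite "\<lambda>_::'i. P t" by standard
    interpret PK: prob_space "\<Pi>\<^sub>M i\<in>K. P t" by (intro prob_space_PiM Q)
    have sets: "sets (\<Pi>\<^sub>M i\<in>J. P t) = sets (\<Pi>\<^sub>M i\<in>J. borel)" for J :: "'i set"
      by (intro sets_PiM_cong refl Q)
    have fin: "finite K" "finite ?L" using \<open>finite W\<close> \<open>K \<subseteq> W\<close> by (auto intro: finite_subset)
    have W: "K \<union> ?L = W" using \<open>K \<subseteq> W\<close> by auto
    have B_t: "B \<in> sets (\<Pi>\<^sub>M i\<in>W. P t)" using B by (simp add: sets)
    have "emeasure (\<Pi>\<^sub>M i\<in>W. P t) B = (\<integral>\<^sup>+x. indicator B x \<partial>(\<Pi>\<^sub>M i\<in>W. P t))"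
      using B_t by simp
    also have "\<dots> = (\<integral>\<^sup>+v. \<integral>\<^sup>+w. indicator B (merge K ?L (v, w)) \<partial>(\<Pi>\<^sub>M i\<in>?L. P t) \<partial>(\<Pi>\<^sub>M i\<in>K. P t))"
      using product_nn_integral_fold[of K ?L "indicator B"] fin B_t unfolding W by auto
    also have "\<dots> \<le> (\<integral>\<^sup>+v. g t \<partial>(\<Pi>\<^sub>M i\<in>K. P t))"
    proof (rule nn_integral_mono)
      fix v assume "v \<in> space (\<Pi>\<^sub>M i\<in>K. P t)"
      then have v: "v \<in> space (\<Pi>\<^sub>M i\<in>K. (borel :: real measure))"
        using sets_eq_imp_space_eq[OF sets] by blast
      have "{w \<in> space (\<Pi>\<^sub>M i\<in>?L. borel). \<Phi> v w} \<in> sets (\<Pi>\<^sub>M i\<in>?L. borel)"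
        using measurable_compose[OF measurable_Pair1'[OF v] assms(4)] by (simp add: pred_def)
      then have ev: "{w \<in> space (\<Pi>\<^sub>M i\<in>?L. P t). \<Phi> v w} \<in> sets (\<Pi>\<^sub>M i\<in>?L. P t)"
        using sets_eq_imp_space_eq[OF sets[of ?L]] by (simp add: sets)
      have "(\<integral>\<^sup>+w. indicator B (merge K ?L (v, w)) \<partial>(\<Pi>\<^sub>M i\<in>?L. P t))
          = (\<integral>\<^sup>+w. indicator {w \<in> space (\<Pi>\<^sub>M i\<in>?L. P t). \<Phi> v w} w \<partial>(\<Pi>\<^sub>M i\<in>?L. P t))"
      proof (rule nn_integral_cong)
        fix w assume w: "w \<in> space (\<Pi>\<^sub>M i\<in>?L. P t)"
        then have "w \<in> space (\<Pi>\<^sub>M i\<in>?L. (borel :: real measure))"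
          using sets_eq_imp_space_eq[OF sets] by blast
        with v have "restrict (merge K ?L (v, w)) K = v" "restrict (merge K ?L (v, w)) ?L = w"
          "merge K ?L (v, w) \<in> space (\<Pi>\<^sub>M i\<in>W. (borel :: real measure))"
          using W by (auto simp: space_PiM PiE_def extensional_restrict extensional_def merge_def fun_eq_iff)
        then show "(indicator B (merge K ?L (v, w)) :: ennreal) = indicator {w \<in> space (\<Pi>\<^sub>M i\<in>?L. P t). \<Phi> v w} w"
          using w by (auto simp: B_def indicator_def)
      qed
      also have "\<dots> \<le> g t" using ev bound[OF t v] by simp
      finally show "(\<integral>\<^sup>+w. indicator B (merge K ?L (v, w)) \<partial>(\<Pi>\<^sub>M i\<in>?L. P t)) \<le> g t" .
    qed
    also have "\<dots> = g t" by (simp add: PK.emeasure_space_1)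
    finally show "emeasure (\<Pi>\<^sub>M i\<in>W. P t) B \<le> g t" .
  qed
  finally show ?thesis .
qed

text \<open>The constant \<open>c\<close> is arbitrary, so this applies to \<open>c\<close> defined as the integral of \<open>f\<close> before \<open>f\<close>
  is known to be integrable.\<close>
lemma (in prob_space) integrable_if_square_deviation:
  fixes f :: "'a \<Rightarrow> real"
  assumes [measurable]: "f \<in> borel_measurable M" and "(\<integral>\<^sup>+y. ennreal (\<bar>f y - c\<bar> ^ 2) \<partial>M) \<le> ennreal K"
  shows "integrable M f"
proof -
  have "integrable M (\<lambda>y. (f y - c)\<^sup>2)"
    using assms(2) by (intro integrableI_bounded) (auto simp: le_less_trans)
  then have "integrable M (\<lambda>y. f y - c)"
    using integrable_power_le(1)[of "\<lambda>y. f y - c" 2 1] by simp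
  then have "integrable M (\<lambda>y. (f y - c) + c)" by (intro Bochner_Integration.integrable_add) auto
  then show ?thesis by simp
qed

section \<open>Stochastic domination\<close>

text \<open>The moment conditions for the transformed variables \<open>z (Y\<^sub>i)\<close>, which cover \<open>Y\<^sub>i\<close> and \<open>1 - Y\<^sub>i\<^sup>2\<close>
  at once. Continuity of \<open>z\<close> makes the mean a measurable function of the mixing parameter.\<close>
locale de_Finetti_forms =
  fixes M :: "nat \<Rightarrow> 'w measure" and W :: "nat \<Rightarrow> 'i set" and Y :: "nat \<Rightarrow> 'i \<Rightarrow> 'w \<Rightarrow> real"
    and \<mu> :: "nat \<Rightarrow> 't measure" and P :: "nat \<Rightarrow> 't \<Rightarrow> real measure" and z :: "real \<Rightarrow> real"
  assumes prob_M: "N \<ge> 1 \<Longrightarrow> prob_space (M N)"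
    and finite_W: "N \<ge> 1 \<Longrightarrow> finite (W N)"
    and de_Finetti: "N \<ge> 1 \<Longrightarrow> de_Finetti_type (M N) (W N) (Y N) (\<mu> N) (P N)"
    and continuous_z: "continuous_on UNIV z"
    and integrable_z: "N \<ge> 1 \<Longrightarrow> t \<in> space (\<mu> N) \<Longrightarrow> integrable (P N t) z"
    and mean_moments: "even p \<Longrightarrow> p > 0 \<Longrightarrow> \<exists>K\<ge>0. \<forall>N\<ge>1.
      (\<integral>\<^sup>+t. ennreal (\<bar>\<integral>x. z x \<partial>P N t\<bar> ^ p) \<partial>\<mu> N) \<le> ennreal (K * real N powr (- real p / 2))"
    and central_moments: "even p \<Longrightarrow> p > 0 \<Longrightarrow> \<exists>K\<ge>0. \<forall>N\<ge>1. \<forall>t\<in>space (\<mu> N).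
      (\<integral>\<^sup>+y. ennreal (\<bar>z y - (\<integral>x. z x \<partial>P N t)\<bar> ^ p) \<partial>P N t) \<le> ennreal K"
begin

abbreviation "mean N t \<equiv> \<integral>x. z x \<partial>P N t"

lemma z_measurable [measurable]: "z \<in> borel_measurable borel"
  using continuous_z by (rule borel_measurable_continuous_onI)

lemma mixing: "N \<ge> 1 \<Longrightarrow> mixing_space (\<mu> N) (P N)"
  using de_Finetti by (simp add: de_Finetti_type_def)

lemma mean_measurable [measurable]: "N \<ge> 1 \<Longrightarrow> mean N \<in> borel_measurable (\<mu> N)"
  using integral_measurable_mixing[OF mixing continuous_z integrable_z] by blast

text \<open>The factor \<open>(2 N)\<^sup>2\<^sup>r\<^sup>+\<^sup>2\<close> cancels against the decay \<open>N\<^sup>-\<^sup>(\<^sup>2\<^sup>r\<^sup>+\<^sup>2\<^sup>)\<close> of the moment of the mean of order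
  \<open>2 (2 r + 2)\<close>, so the integrated tail bound is uniform in \<open>N\<close>.\<close>
lemma nn_integral_tail_le:
  assumes N: "N \<ge> 1" and "0 \<le> c" "0 < h" "0 \<le> K"
    and K: "(\<integral>\<^sup>+t. ennreal (\<bar>mean N t\<bar> ^ (2 * (2 * r + 2))) \<partial>\<mu> N)
          \<le> ennreal (K * real N powr (- real (2 * (2 * r + 2)) / 2))"
  shows "(\<integral>\<^sup>+t. ennreal (c * (1 + ((real (2 * N) * (mean N t)\<^sup>2) ^ (r + 1))\<^sup>2) / h) \<partial>\<mu> N)
         \<le> ennreal (c * (1 + 2 ^ (2 * r + 2) * K) / h)"
proof -
  let ?p = "2 * r + 2"
  interpret \<mu>: prob_space "\<mu> N" using mixing[OF N] by (simp add: mixing_space_def)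
  note [measurable] = mean_measurable[OF N]
  have scale: "((real (2 * N) * x\<^sup>2) ^ (r + 1))\<^sup>2 = real (2 * N) ^ ?p * \<bar>x\<bar> ^ (2 * ?p)" for x :: real
  proof -
    have "((real (2 * N) * x\<^sup>2) ^ (r + 1))\<^sup>2 = (real (2 * N) * x\<^sup>2) ^ ?p"
      by (simp only: power_mult[symmetric]) (simp add: mult.commute)
    also have "\<dots> = real (2 * N) ^ ?p * \<bar>x\<bar> ^ (2 * ?p)"
      by (simp only: power_mult_distrib power_mult power2_abs)
    finally show ?thesis .
  qed
  have "(\<integral>\<^sup>+t. ennreal (c * (1 + ((real (2 * N) * (mean N t)\<^sup>2) ^ (r + 1))\<^sup>2) / h) \<partial>\<mu> N)
      = (\<integral>\<^sup>+t. ennreal (c / h) + ennreal (c / h * real (2 * N) ^ ?p) * ennreal (\<bar>mean N t\<bar> ^ (2 * ?p)) \<partial>\<mu> N)"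
    unfolding scale using \<open>0 \<le> c\<close> \<open>0 < h\<close>
    by (intro nn_integral_cong)
       (simp add: ennreal_mult[symmetric] ennreal_plus[symmetric] add_divide_distrib algebra_simps del: ennreal_plus power_Suc)
  also have "\<dots> = ennreal (c / h) + ennreal (c / h * real (2 * N) ^ ?p) * (\<integral>\<^sup>+t. ennreal (\<bar>mean N t\<bar> ^ (2 * ?p)) \<partial>\<mu> N)"
    by (subst nn_integral_add) (simp_all add: nn_integral_cmult \<mu>.emeasure_space_1 del: power_Suc)
  also have "\<dots> \<le> ennreal (c / h) + ennreal (c / h * real (2 * N) ^ ?p) * ennreal (K * real N powr (- real (2 * ?p) / 2))"
    by (intro add_left_mono mult_left_mono K) auto
  also have "\<dots> = ennreal (c / h + c / h * real (2 * N) ^ ?p * (K * real N powr (- real (2 * ?p) / 2)))"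
    using \<open>0 \<le> c\<close> \<open>0 < h\<close> \<open>0 \<le> K\<close> by (simp add: ennreal_mult[symmetric] ennreal_plus[symmetric] del: ennreal_plus power_Suc)
  also have "real N powr (- real (2 * ?p) / 2) = 1 / real N ^ ?p"
  proof -
    have "- real (2 * ?p) / 2 = - real ?p" by simp
    then show ?thesis using N by (simp only: powr_minus powr_realpow) (simp add: powr_realpow field_simps del: power_Suc add: powr_minus)
  qed
  also have "c / h + c / h * real (2 * N) ^ ?p * (K * (1 / real N ^ ?p)) = c * (1 + 2 ^ ?p * K) / h"
  proof -
    have "real (2 * N) ^ ?p = 2 ^ ?p * real N ^ ?p" by (simp only: of_nat_mult power_mult_distrib of_nat_numeral)
    then show ?thesis using N \<open>0 < h\<close> by (simp add: field_simps del: power_Suc)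
  qed
  finally show ?thesis .
qed

text \<open>Everything but the shape of the form. A parameter \<open>u\<close> of the family determines the set \<open>Kf u\<close> of
  frozen indices, the set \<open>If u\<close> of indices of the variables in the form, the form \<open>F u v w\<close> at
  \<open>Y\<^sub>K = v\<close> and the remaining variables \<open>w\<close>, and its size \<open>G u v\<close>. The tail bound is required for any
  independent sample; the constants \<open>r\<close> and \<open>K\<close> are then fixed from \<open>\<epsilon>\<close>, \<open>D\<close> and the moment conditions
  alone, so the resulting constant is uniform in \<open>u\<close> and \<open>N\<close>. The bound \<open>2 N\<close> instead of \<open>N\<close> leaves
  room for the union of the two index sets of a bilinear form.\<close>
lemma stoch_dominated_if_conditional_tail:
  fixes U :: "nat \<Rightarrow> 'u set" and Kf If :: "'u \<Rightarrow> 'i set"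
  assumes sub: "\<And>N u. N \<ge> 1 \<Longrightarrow> u \<in> U N \<Longrightarrow> Kf u \<subseteq> W N \<and> If u \<subseteq> W N - Kf u \<and> card (If u) \<le> 2 * N"
    and F_meas: "\<And>N u. N \<ge> 1 \<Longrightarrow> u \<in> U N \<Longrightarrow>
        (\<lambda>(v, w). F u v w) \<in> borel_measurable ((\<Pi>\<^sub>M i\<in>Kf u. borel) \<Otimes>\<^sub>M (\<Pi>\<^sub>M i\<in>W N - Kf u. borel))"
    and G_meas: "\<And>N u. N \<ge> 1 \<Longrightarrow> u \<in> U N \<Longrightarrow> G u \<in> borel_measurable (\<Pi>\<^sub>M i\<in>Kf u. borel)"
    and X: "\<And>N u \<omega>. N \<ge> 1 \<Longrightarrow> u \<in> U N \<Longrightarrow>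
        X N u \<omega> = F u (subtuple (Y N) (Kf u) \<omega>) (subtuple (Y N) (W N - Kf u) \<omega>)"
    and S: "\<And>N u \<omega>. N \<ge> 1 \<Longrightarrow> u \<in> U N \<Longrightarrow> S N u \<omega> = G u (subtuple (Y N) (Kf u) \<omega>)"
    and tail: "\<And>N u Q m K r h v. \<lbrakk>N \<ge> 1; u \<in> U N; 0 < h; independent_sample Q (\<lambda>i w. z (w i)) (If u) m K (2 * N) r\<rbrakk>
      \<Longrightarrow> measure Q {w \<in> space Q. cmod (F u v w) > h * G u v}
        \<le> 2 ^ (r + 2) * (form_const r K * (1 + ((real (2 * N) * m\<^sup>2) ^ (r + 1))\<^sup>2)) / h ^ (2 * r + 2)"
  shows "stoch_dominated M U X S"
  unfolding stoch_dominated_def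
proof (intro allI impI)
  fix \<epsilon> D :: real assume \<epsilon>: "0 < \<epsilon>" and D: "0 < D"
  \<comment> \<open>With this \<open>r\<close> the factor \<open>h\<^sup>-\<^sup>p = N\<^sup>-\<^sup>\<epsilon>\<^sup>p\<close> from Markov's inequality is at most \<open>N\<^sup>-\<^sup>D\<close>.\<close>
  define r where "r = nat \<lceil>D / \<epsilon>\<rceil>"
  let ?p = "2 * r + 2"
  have "D / \<epsilon> \<le> real r" unfolding r_def by (rule real_nat_ceiling_ge)
  then have r: "D \<le> \<epsilon> * real ?p" using \<epsilon> D by (simp add: field_simps)
  obtain K where K: "0 \<le> K" "\<And>N t. N \<ge> 1 \<Longrightarrow> t \<in> space (\<mu> N) \<Longrightarrow>
      (\<integral>\<^sup>+y. ennreal (\<bar>z y - mean N t\<bar> ^ ?p) \<partial>P N t) \<le> ennreal K"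
    using central_moments[of ?p] by auto
  obtain K' where K': "0 \<le> K'" "\<And>N. N \<ge> 1 \<Longrightarrow> (\<integral>\<^sup>+t. ennreal (\<bar>mean N t\<bar> ^ (2 * ?p)) \<partial>\<mu> N)
      \<le> ennreal (K' * real N powr (- real (2 * ?p) / 2))"
    using mean_moments[of "2 * ?p"] by auto
  define c where "c = 2 ^ (r + 2) * form_const r K"
  define C where "C = c * (1 + 2 ^ ?p * K')"
  have c: "0 \<le> c" using form_const_nonneg[OF K(1)] by (simp add: c_def)
  have C: "0 \<le> C" using c K'(1) by (simp add: C_def)
  show "\<exists>C\<ge>0. \<forall>N\<ge>1. \<forall>u\<in>U N. measure (M N) {\<omega> \<in> space (M N). cmod (X N u \<omega>) > real N powr \<epsilon> * S N u \<omega>}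
      \<le> C * real N powr (- D)"
  proof (intro exI conjI allI impI ballI)
    fix N :: nat and u assume N: "1 \<le> N" and u: "u \<in> U N"
    interpret M: prob_space "M N" using N by (rule prob_M)
    define h where "h = real N powr \<epsilon>"
    have h: "0 < h" using N by (simp add: h_def)
    note [measurable] = G_meas[OF N u]
    let ?E = "{\<omega> \<in> space (M N). cmod (X N u \<omega>) > h * S N u \<omega>}"
    have "emeasure (M N) ?E \<le> (\<integral>\<^sup>+t. ennreal (c * (1 + ((real (2 * N) * (mean N t)\<^sup>2) ^ (r + 1))\<^sup>2) / h ^ ?p) \<partial>\<mu> N)"
      unfolding X[OF N u] S[OF N u]
    proof (rule de_Finetti_conditional_bound[OF de_Finetti[OF N] finite_W[OF N]])
      show "Kf u \<subseteq> W N" using sub[OF N u] by simp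
      show "Measurable.pred ((\<Pi>\<^sub>M i\<in>Kf u. borel) \<Otimes>\<^sub>M (\<Pi>\<^sub>M i\<in>W N - Kf u. borel)) (\<lambda>(v, w). h * G u v < cmod (F u v w))"
        using F_meas[OF N u] by (simp add: case_prod_unfold)
      fix t v assume t: "t \<in> space (\<mu> N)"
      note Q = mixing_space_borel_prob[OF mixing[OF N] t]
      interpret Q: prob_space "\<Pi>\<^sub>M i\<in>W N - Kf u. P N t" by (intro prob_space_PiM Q)
      have "independent_sample (\<Pi>\<^sub>M i\<in>W N - Kf u. P N t) (\<lambda>i w. z (w i)) (If u) (mean N t) K (2 * N) r"
        using sub[OF N u] finite_W[OF N] K(2)[OF N t] integrable_z[OF N t] K(1)
        by (intro independent_sample_PiM Q) auto
      from tail[OF N u h this, of v]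
      show "emeasure (\<Pi>\<^sub>M i\<in>W N - Kf u. P N t) {w \<in> space (\<Pi>\<^sub>M i\<in>W N - Kf u. P N t). h * G u v < cmod (F u v w)}
          \<le> ennreal (c * (1 + ((real (2 * N) * (mean N t)\<^sup>2) ^ (r + 1))\<^sup>2) / h ^ ?p)"
        unfolding Q.emeasure_eq_measure c_def mult.assoc by (rule ennreal_leI)
    qed
    also have "\<dots> \<le> ennreal (C / h ^ ?p)"
      unfolding C_def by (rule nn_integral_tail_le[OF N c _ K'(1) K'(2)[OF N]]) (use h in simp)
    finally have "measure (M N) ?E \<le> C / h ^ ?p"
      using C h unfolding M.emeasure_eq_measure by (subst (asm) ennreal_le_iff) auto
    also have "\<dots> = C * real N powr (- (\<epsilon> * real ?p))"
    proof -
      have "h ^ ?p = real N powr (\<epsilon> * real ?p)"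
        using N by (simp only: h_def powr_powr[symmetric] powr_realpow h[unfolded h_def])
      then show ?thesis by (simp add: powr_minus divide_inverse)
    qed
    also have "\<dots> \<le> C * real N powr (- D)"
      using N r C by (intro mult_left_mono powr_mono) auto
    finally show "measure (M N) {\<omega> \<in> space (M N). cmod (X N u \<omega>) > real N powr \<epsilon> * S N u \<omega>} \<le> C * real N powr (- D)"
      unfolding h_def .
  qed (rule C)
qed

lemma linear_bound_z: "linear_bound M W Y (\<lambda>N i \<omega>. z (Y N i \<omega>))"
  unfolding linear_bound_def
proof (rule stoch_dominated_if_conditional_tail[where
      Kf = "\<lambda>(I, K, B). K" and If = "\<lambda>(I, K, B). I" and
      F = "\<lambda>(I, K, B) v w. \<Sum>i\<in>I. B i v * complex_of_real (z (w i))" and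
      G = "\<lambda>(I, K, B) v. sqrt (\<Sum>i\<in>I. (cmod (B i v))\<^sup>2)"], goal_cases)
  case (2 N u)
  then obtain I K B where u: "u = (I, K, B)" and "I \<subseteq> W N" "I \<inter> K = {}" and B: "B \<in> fun_tuples (W N) K" by auto
  then have I: "I \<subseteq> W N - K" by auto
  have [measurable]: "i \<in> I \<Longrightarrow> B i \<in> borel_measurable (\<Pi>\<^sub>M k\<in>K. borel)" "i \<in> I \<Longrightarrow> i \<in> W N - K" for i
    using B I by (auto simp: fun_tuples_def)
  show ?case unfolding u by simp
next
  case (3 N u)
  then obtain I K B where u: "u = (I, K, B)" and "I \<subseteq> W N" "I \<inter> K = {}" and B: "B \<in> fun_tuples (W N) K" by auto
  then have I: "I \<subseteq> W N - K" by auto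
  have [measurable]: "i \<in> I \<Longrightarrow> B i \<in> borel_measurable (\<Pi>\<^sub>M k\<in>K. borel)" for i
    using B I by (auto simp: fun_tuples_def)
  show ?case unfolding u by simp
next
  case (4 N u \<omega>)
  then show ?case by (auto simp: subtuple_def intro!: sum.cong)
next
  case (6 N u Q m K r h v)
  interpret independent_sample Q "\<lambda>i w. z (w i)" "(\<lambda>(I, K, B). I) u" m K "2 * N" r by fact
  show ?case using linear_form_tail[OF 6(3)] by (auto simp: case_prod_unfold)
qed auto

lemma off_diagonal_bound_z: "off_diagonal_bound M W Y (\<lambda>N i \<omega>. z (Y N i \<omega>))"
  unfolding off_diagonal_bound_def off_diag_def[symmetric]
proof (rule stoch_dominated_if_conditional_tail[where
      Kf = "\<lambda>(I, K, A). K" and If = "\<lambda>(I, K, A). I" and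
      F = "\<lambda>(I, K, A) v w. \<Sum>(i, j)\<in>off_diag I. complex_of_real (z (w i)) * A i j v * complex_of_real (z (w j))" and
      G = "\<lambda>(I, K, A) v. sqrt (\<Sum>(i, j)\<in>off_diag I. (cmod (A i j v))\<^sup>2)"], goal_cases)
  case (2 N u)
  then obtain I K A where u: "u = (I, K, A)" and "I \<subseteq> W N" "I \<inter> K = {}" and A: "A \<in> fun_tuples2 (W N) K" by auto
  then have I: "I \<subseteq> W N - K" by auto
  have index [measurable]: "x \<in> off_diag I \<Longrightarrow> fst x \<in> W N - K" "x \<in> off_diag I \<Longrightarrow> snd x \<in> W N - K" for x
    using I by (auto simp: off_diag_def)
  have [measurable]: "x \<in> off_diag I \<Longrightarrow> A (fst x) (snd x) \<in> borel_measurable (\<Pi>\<^sub>M k\<in>K. borel)" for x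
    using A index[of x] unfolding fun_tuples2_def by blast
  show ?case unfolding u by (simp add: case_prod_unfold)
next
  case (3 N u)
  then obtain I K A where u: "u = (I, K, A)" and "I \<subseteq> W N" "I \<inter> K = {}" and A: "A \<in> fun_tuples2 (W N) K" by auto
  then have I: "I \<subseteq> W N - K" by auto
  have index [measurable]: "x \<in> off_diag I \<Longrightarrow> fst x \<in> W N - K" "x \<in> off_diag I \<Longrightarrow> snd x \<in> W N - K" for x
    using I by (auto simp: off_diag_def)
  have [measurable]: "x \<in> off_diag I \<Longrightarrow> A (fst x) (snd x) \<in> borel_measurable (\<Pi>\<^sub>M k\<in>K. borel)" for x
    using A index[of x] unfolding fun_tuples2_def by blast
  show ?case unfolding u by (simp add: case_prod_unfold)
next
  case (4 N u \<omega>)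
  then show ?case by (auto simp: subtuple_def off_diag_def intro!: sum.cong)
next
  case (6 N u Q m K r h v)
  interpret independent_sample Q "\<lambda>i w. z (w i)" "(\<lambda>(I, K, A). I) u" m K "2 * N" r by fact
  show ?case using off_diag_form_tail[OF 6(3)] by (auto simp: case_prod_unfold)
qed auto

lemma bilinear_bound_z: "bilinear_bound M W Y (\<lambda>N i \<omega>. z (Y N i \<omega>))"
  unfolding bilinear_bound_def
proof (rule stoch_dominated_if_conditional_tail[where
      Kf = "\<lambda>(I, J, K, A). K" and If = "\<lambda>(I, J, K, A). I \<union> J" and
      F = "\<lambda>(I, J, K, A) v w. \<Sum>(i, j)\<in>I \<times> J. complex_of_real (z (w i)) * A i j v * complex_of_real (z (w j))" and
      G = "\<lambda>(I, J, K, A) v. sqrt (\<Sum>(i, j)\<in>I \<times> J. (cmod (A i j v))\<^sup>2)"], goal_cases)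
  case (1 N u)
  then show ?case by (auto intro: order_trans[OF card_Un_le])
next
  case (2 N u)
  then obtain I J K A where u: "u = (I, J, K, A)" and "I \<union> J \<subseteq> W N" "I \<inter> K = {}" "J \<inter> K = {}" and A: "A \<in> fun_tuples2 (W N) K" by auto
  then have IJ: "I \<union> J \<subseteq> W N - K" by auto
  have index [measurable]: "x \<in> I \<times> J \<Longrightarrow> fst x \<in> W N - K" "x \<in> I \<times> J \<Longrightarrow> snd x \<in> W N - K" for x
    using IJ by auto
  have [measurable]: "x \<in> I \<times> J \<Longrightarrow> A (fst x) (snd x) \<in> borel_measurable (\<Pi>\<^sub>M k\<in>K. borel)" for x
    using A index[of x] unfolding fun_tuples2_def by blast
  show ?case unfolding u by (simp add: case_prod_unfold)
next
  case (3 N u)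
  then obtain I J K A where u: "u = (I, J, K, A)" and "I \<union> J \<subseteq> W N" "I \<inter> K = {}" "J \<inter> K = {}" and A: "A \<in> fun_tuples2 (W N) K" by auto
  then have IJ: "I \<union> J \<subseteq> W N - K" by auto
  have index [measurable]: "x \<in> I \<times> J \<Longrightarrow> fst x \<in> W N - K" "x \<in> I \<times> J \<Longrightarrow> snd x \<in> W N - K" for x
    using IJ by auto
  have [measurable]: "x \<in> I \<times> J \<Longrightarrow> A (fst x) (snd x) \<in> borel_measurable (\<Pi>\<^sub>M k\<in>K. borel)" for x
    using A index[of x] unfolding fun_tuples2_def by blast
  show ?case unfolding u by (simp add: case_prod_unfold)
next
  case (4 N u \<omega>)
  then show ?case by (auto simp: subtuple_def intro!: sum.cong)
next
  case (6 N u Q m K r h v)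
  then obtain I J K' A where u: "u = (I, J, K', A)" and IJ: "I \<union> J \<subseteq> W N" "I \<inter> J = {}" by auto
  interpret independent_sample Q "\<lambda>i w. z (w i)" "I \<union> J" m K "2 * N" r using 6(4) by (simp add: u)
  have fin: "finite I" "finite J" using finite_I by auto
  let ?A = "\<lambda>i j. if i \<in> I \<and> j \<in> J then A i j v else 0"
  have form_eq: "(\<Sum>(i, j)\<in>I \<times> J. complex_of_real (z (w i)) * A i j v * complex_of_real (z (w j)))
      = (\<Sum>(i, j)\<in>off_diag (I \<union> J). complex_of_real (z (w i)) * ?A i j * complex_of_real (z (w j)))" for w
    by (rule sum_Times_eq_off_diag[OF fin IJ(2)]) simp
  have size_eq: "(\<Sum>(i, j)\<in>I \<times> J. (cmod (A i j v))\<^sup>2) = (\<Sum>(i, j)\<in>off_diag (I \<union> J). (cmod (?A i j))\<^sup>2)"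
    by (rule sum_Times_eq_off_diag[OF fin IJ(2)]) simp
  show ?case unfolding u prod.case form_eq size_eq by (rule off_diag_form_tail[OF 6(3)])
qed auto

end

theorem theorem20:
  fixes M :: "nat \<Rightarrow> 'w measure"
    and W :: "nat \<Rightarrow> 'i set"
    and Y :: "nat \<Rightarrow> 'i \<Rightarrow> 'w \<Rightarrow> real"
    and \<mu> :: "nat \<Rightarrow> 't measure"
    and P :: "nat \<Rightarrow> 't \<Rightarrow> real measure"
  assumes "\<And>N. N \<ge> 1 \<Longrightarrow> prob_space (M N)"
    and "\<And>N. N \<ge> 1 \<Longrightarrow> finite (W N)"
    and "\<And>N i. N \<ge> 1 \<Longrightarrow> i \<in> W N \<Longrightarrow> Y N i \<in> borel_measurable (M N)"
    and "\<And>N. N \<ge> 1 \<Longrightarrow> de_Finetti_type (M N) (W N) (Y N) (\<mu> N) (P N)"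
  shows "(first_moment_condition \<mu> P \<and> central_first_moment_condition \<mu> P \<longrightarrow>
            linear_bound M W Y Y \<and> bilinear_bound M W Y Y \<and> off_diagonal_bound M W Y Y) \<and>
         (second_moment_condition \<mu> P \<and> central_second_moment_condition \<mu> P \<longrightarrow>
            linear_bound M W Y (\<lambda>N i \<omega>. 1 - (Y N i \<omega>)\<^sup>2) \<and>
            bilinear_bound M W Y (\<lambda>N i \<omega>. 1 - (Y N i \<omega>)\<^sup>2) \<and>
            off_diagonal_bound M W Y (\<lambda>N i \<omega>. 1 - (Y N i \<omega>)\<^sup>2))"
proof (intro conjI[of "_ \<longrightarrow> _"] impI; elim conjE)
  have Q: "prob_space (P N t)" "sets (P N t) = sets borel" if "N \<ge> 1" "t \<in> space (\<mu> N)" for N t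
    using mixing_space_borel_prob[OF _ that(2)] assms(4)[OF that(1)] by (auto simp: de_Finetti_type_def)
  have int: "integrable (P N t) f" if N: "N \<ge> 1" "t \<in> space (\<mu> N)" and f: "f \<in> borel_measurable borel"
    and sup: "\<exists>K\<ge>0. \<forall>N\<ge>1. (SUP t\<in>space (\<mu> N). \<integral>\<^sup>+y. ennreal (\<bar>f y - c N t\<bar> ^ 2) \<partial>P N t) \<le> ennreal K"
    for N t and f :: "real \<Rightarrow> real" and c
  proof -
    obtain K where "(\<integral>\<^sup>+y. ennreal (\<bar>f y - c N t\<bar> ^ 2) \<partial>P N t) \<le> ennreal K"
      using sup N by (auto simp: SUP_le_iff)
    moreover have "f \<in> borel_measurable (P N t)" using f measurable_cong_sets[OF Q(2)[OF N] refl] by blast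
    ultimately show ?thesis by (intro prob_space.integrable_if_square_deviation[OF Q(1)[OF N]])
  qed
  {
    assume first: "first_moment_condition \<mu> P" and central: "central_first_moment_condition \<mu> P"
    interpret de_Finetti_forms M W Y \<mu> P "\<lambda>y. y"
    proof (rule de_Finetti_forms.intro)
      show "integrable (P N t) (\<lambda>y. y)" if "N \<ge> 1" "t \<in> space (\<mu> N)" for N t
        using central[unfolded central_first_moment_condition_def, rule_format, of 2] that
        by (intro int[where c = "\<lambda>N t. moment P N 1 t"]) auto
      show "\<exists>K\<ge>0. \<forall>N\<ge>1. (\<integral>\<^sup>+t. ennreal (\<bar>\<integral>x. x \<partial>P N t\<bar> ^ p) \<partial>\<mu> N) \<le> ennreal (K * real N powr (- real p / 2))"
        if "even p" "p > 0" for p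
        using first that by (simp add: first_moment_condition_def moment_def)
      show "\<exists>K\<ge>0. \<forall>N\<ge>1. \<forall>t\<in>space (\<mu> N). (\<integral>\<^sup>+y. ennreal (\<bar>y - (\<integral>x. x \<partial>P N t)\<bar> ^ p) \<partial>P N t) \<le> ennreal K"
        if "even p" "p > 0" for p
        using central that by (simp add: central_first_moment_condition_def moment_def SUP_le_iff)
    qed (rule continuous_on_id assms(1) assms(2) assms(4); assumption?)+
    show "linear_bound M W Y Y \<and> bilinear_bound M W Y Y \<and> off_diagonal_bound M W Y Y"
      using linear_bound_z bilinear_bound_z off_diagonal_bound_z by simp
  next
    assume second: "second_moment_condition \<mu> P" and central: "central_second_moment_condition \<mu> P"
    have sq: "integrable (P N t) (\<lambda>y. y\<^sup>2)" if "N \<ge> 1" "t \<in> space (\<mu> N)" for N t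
      using central[unfolded central_second_moment_condition_def, rule_format, of 2] that
      by (intro int[where c = "\<lambda>N t. moment P N 2 t"]) auto
    have mean: "(\<integral>x. 1 - x\<^sup>2 \<partial>P N t) = 1 - moment P N 2 t" if "N \<ge> 1" "t \<in> space (\<mu> N)" for N t
    proof -
      interpret prob_space "P N t" using Q(1)[OF that] .
      show ?thesis using sq[OF that] by (simp add: moment_def prob_space)
    qed
    interpret de_Finetti_forms M W Y \<mu> P "\<lambda>y. 1 - y\<^sup>2"
    proof (rule de_Finetti_forms.intro)
      show "continuous_on UNIV (\<lambda>y::real. 1 - y\<^sup>2)" by (intro continuous_intros)
      show "integrable (P N t) (\<lambda>y. 1 - y\<^sup>2)" if "N \<ge> 1" "t \<in> space (\<mu> N)" for N t
      proof -
        interpret prob_space "P N t" using Q(1)[OF that] .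
        show ?thesis using sq[OF that] by simp
      qed
      show "\<exists>K\<ge>0. \<forall>N\<ge>1. (\<integral>\<^sup>+t. ennreal (\<bar>\<integral>x. 1 - x\<^sup>2 \<partial>P N t\<bar> ^ p) \<partial>\<mu> N) \<le> ennreal (K * real N powr (- real p / 2))"
        if "even p" "p > 0" for p
        using second that by (simp add: second_moment_condition_def mean cong: nn_integral_cong)
      show "\<exists>K\<ge>0. \<forall>N\<ge>1. \<forall>t\<in>space (\<mu> N). (\<integral>\<^sup>+y. ennreal (\<bar>1 - y\<^sup>2 - (\<integral>x. 1 - x\<^sup>2 \<partial>P N t)\<bar> ^ p) \<partial>P N t) \<le> ennreal K"
        if "even p" "p > 0" for p
        using central that
        by (simp add: central_second_moment_condition_def mean SUP_le_iff abs_minus_commute)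
    qed (rule continuous_on_id assms(1) assms(2) assms(4); assumption?)+
    show "linear_bound M W Y (\<lambda>N i \<omega>. 1 - (Y N i \<omega>)\<^sup>2) \<and>
          bilinear_bound M W Y (\<lambda>N i \<omega>. 1 - (Y N i \<omega>)\<^sup>2) \<and>
          off_diagonal_bound M W Y (\<lambda>N i \<omega>. 1 - (Y N i \<omega>)\<^sup>2)"
      using linear_bound_z bilinear_bound_z off_diagonal_bound_z by simp
  }
qed

end
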